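(* Let $\delta>0$, $\varepsilon>0$ and $c>1$ be given constants. Then there is a unique (up to translations in $\xi$) global solution $(u,v)$, defined for all $\xi\in\mathbb{R}$, of the system $$u' = (\delta c)^{-1}v,\qquad v' = cu + \frac{u}{u-c} - \frac{1}{2}u^2 + \varepsilon(\delta c)^{-1}v ,$$ whose orbit $\mathcal{R}=\{(u(\xi),v(\xi)):\xi\in\mathbb{R}\}$ in the phase plane is bounded, is contained in $\mathcal{M}=\{(u,v)\in\mathbb{R}^2: 0<u<c\}$, tends to $(u_0,0)$ as $\xi\to-\infty$, and tends to $(0,0)$ as $\xi\to+\infty$.
   Context: Here $'=d/d\xi$ and $u_0=\dfrac{3c-\sqrt{c^2+8}}{2}$. "Unique up to translations in $\xi$" means that any two such solutions differ by a shift $\xi\mapsto\xi+\xi_*$ of the independent variable. *)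

theory Defs
  imports "HOL-Analysis.Analysis"
begin

(* Phase-plane points are pairs (u, v); a solution is a curve defined on all of the real line.
   The vector field is singular on the line u = c, where Isabelle's u / 0 = 0 gives it a
   meaningless value; this is immaterial for curves that stay in the region 0 < u < c. *)

definition vector_field :: "real \<Rightarrow> real \<Rightarrow> real \<Rightarrow> real \<times> real \<Rightarrow> real \<times> real" where
  "vector_field \<delta> \<epsilon> c = (\<lambda>(u, v).
     (inverse (\<delta> * c) * v,
      c * u + u / (u - c) - (1 / 2) * u\<^sup>2 + \<epsilon> * inverse (\<delta> * c) * v))"

definition global_solution ::
  "real \<Rightarrow> real \<Rightarrow> real \<Rightarrow> (real \<Rightarrow> real) \<Rightarrow> (real \<Rightarrow> real) \<Rightarrow> bool" where
  "global_solution \<delta> \<epsilon> c u v \<longleftrightarrow>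
     (\<forall>\<xi>. (u has_real_derivative fst (vector_field \<delta> \<epsilon> c (u \<xi>, v \<xi>))) (at \<xi>) \<and>
          (v has_real_derivative snd (vector_field \<delta> \<epsilon> c (u \<xi>, v \<xi>))) (at \<xi>))"

definition u0 :: "real \<Rightarrow> real" where
  "u0 c = (3 * c - sqrt (c\<^sup>2 + 8)) / 2"

definition region_M :: "real \<Rightarrow> (real \<times> real) set" where
  "region_M c = {(u, v). 0 < u \<and> u < c}"

definition orbit :: "(real \<Rightarrow> real) \<Rightarrow> (real \<Rightarrow> real) \<Rightarrow> (real \<times> real) set" where
  "orbit u v = {(u \<xi>, v \<xi>) | \<xi>. True}"

definition connecting_solution ::
  "real \<Rightarrow> real \<Rightarrow> real \<Rightarrow> (real \<Rightarrow> real) \<Rightarrow> (real \<Rightarrow> real) \<Rightarrow> bool" where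
  "connecting_solution \<delta> \<epsilon> c u v \<longleftrightarrow>
     global_solution \<delta> \<epsilon> c u v \<and>
     bounded (orbit u v) \<and>
     orbit u v \<subseteq> region_M c \<and>
     ((\<lambda>\<xi>. (u \<xi>, v \<xi>)) \<longlongrightarrow> (u0 c, 0)) at_bot \<and>
     ((\<lambda>\<xi>. (u \<xi>, v \<xi>)) \<longlongrightarrow> (0, 0)) at_top"

end

theory Submission
  imports Defs
begin

text \<open>In reversed time \<open>t = - \<xi>\<close> the system is a damped oscillator
  \<open>x'' = a f(x) - k x'\<close>, with \<open>a = 1 / (\<delta> c)\<close> and \<open>k = \<epsilon> a\<close>, whose potential energy \<open>- a F(x)\<close>,
  \<open>F' = f\<close>, has a maximum at \<open>0\<close> and a well with bottom \<open>u0\<close>; it tends to infinity at \<open>c\<close>.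
  The wanted orbit is the branch \<open>x > 0\<close> of the unstable manifold of the saddle \<open>0\<close>. On it the
  energy decreases from \<open>0\<close>, so it stays in the well; there \<open>x'\<close> and \<open>x''\<close> tend to \<open>0\<close>,
  which leaves only \<open>u0\<close> as a limit. Conversely, every connecting orbit enters the saddle as a graph
  \<open>v = W(u) < 0\<close>, and the squared distance of two such graphs is nonincreasing in \<open>u\<close> and
  vanishes at \<open>u = 0\<close>.\<close>

section \<open>Volterra equations and regular singular points\<close>

text \<open>Reversing time turns \<open>\<epsilon> * a * v\<close> into friction and makes the orbit
  leave the saddle instead of entering it. Two obstacles shape its construction: it has no initial
  point, only a limit in the infinite past, and the force blows up at \<open>u = c\<close>. The
  substitution \<open>x = r * Y r\<close>, \<open>r = exp (l * t)\<close> moves the infinite past to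
  \<open>r = 0\<close>, where \<open>Y 0 = 1\<close> is a genuine initial value. The quadratic
  remainder of the force is frozen beyond some \<open>b < c\<close>, so that the nonlinearity in the
  equation for \<open>Y\<close> is bounded and Lipschitz uniformly in \<open>r\<close>. One fixed
  point on \<open>{0..}\<close> then yields the orbit for all times, without a continuation
  argument. The cut-off is removed afterwards: \<open>b\<close> satisfies
  \<open>potential c b < 0\<close>, whereas negative energy forces the potential function to be
  positive along the orbit, so \<open>b\<close> is never reached.\<close>

lemma abs_integral_le:
  fixes f g :: "real \<Rightarrow> real"
  assumes "continuous_on {a..b} f" "continuous_on {a..b} g"
    and "\<And>s. s \<in> {a..b} \<Longrightarrow> \<bar>f s\<bar> \<le> g s"
  shows "\<bar>integral {a..b} f\<bar> \<le> integral {a..b} g"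
  using integral_norm_bound_integral[of f "{a..b}" g] assms
  by (simp add: integrable_continuous_real)

lemma integral_exp_mult:
  fixes K r :: real
  assumes "K > 0" "r \<ge> 0"
  shows "integral {0..r} (\<lambda>s. exp (K * s)) = (exp (K * r) - 1) / K"
proof -
  have "((\<lambda>s. exp (K * s)) has_integral (exp (K * r) / K - exp (K * 0) / K)) {0..r}"
    by (rule fundamental_theorem_of_calculus[OF \<open>r \<ge> 0\<close>])
       (use \<open>K > 0\<close> in \<open>auto intro!: derivative_eq_intros
          simp: has_real_derivative_iff_has_vector_derivative[symmetric]\<close>)
  then show ?thesis by (simp add: integral_unique diff_divide_distrib)
qed

text \<open>A contraction for the sup norm weighted by \<open>exp (- 2 L r)\<close>, hence no restriction on the
  length of the interval.\<close>

lemma volterra_exists: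
  fixes N :: "(real \<Rightarrow> real) \<Rightarrow> real \<Rightarrow> real"
  assumes cont: "\<And>x. continuous_on {0..} x \<Longrightarrow> continuous_on {0..} (N x)"
    and bound: "\<And>x r. continuous_on {0..} x \<Longrightarrow> 0 \<le> r \<Longrightarrow> \<bar>N x r\<bar> \<le> B"
    and "L > 0"
    and lip: "\<And>x y r d. continuous_on {0..} x \<Longrightarrow> continuous_on {0..} y \<Longrightarrow> 0 \<le> r \<Longrightarrow>
      (\<And>s. s \<in> {0..r} \<Longrightarrow> \<bar>x s - y s\<bar> \<le> d) \<Longrightarrow> \<bar>N x r - N y r\<bar> \<le> L * d"
  shows "\<exists>y. continuous_on {0..} y \<and> (\<forall>r\<ge>0. y r = \<eta> + integral {0..r} (N y))"
proof -
  \<comment> \<open>Integrating the weight \<open>exp (K * s)\<close> gains a factor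
    \<open>1 / K\<close>, so the contraction constant is \<open>L / K\<close>, here 1/2.\<close>
  define K where "K = 2 * L"
  have "K > 0" using \<open>L > 0\<close> by (simp add: K_def)
  \<comment> \<open>\<open>\<Phi>\<close> stands for the weighted unknown
    \<open>exp (- K * s) * x s\<close>, and \<open>U\<close> removes the weight. The fixed point is
    sought among bounded continuous functions on the whole line, hence the constant extension by
    \<open>max 0 r\<close> in \<open>T\<close>.\<close>
  define U where "U \<Phi> = (\<lambda>s. exp (K * s) * apply_bcontfun \<Phi> s)" for \<Phi> :: "real \<Rightarrow>\<^sub>C real"
  define J where "J x r = \<eta> + integral {0..r} (N x)" for x r
  define T where "T \<Phi> = (\<lambda>r. exp (- K * max 0 r) * J (U \<Phi>) (max 0 r))" for \<Phi>
  have U: "continuous_on {0..} (U \<Phi>)" for \<Phi>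
    unfolding U_def by (intro continuous_intros continuous_on_apply_bcontfun)
  have N: "continuous_on {0..r} (N x)" if "continuous_on {0..} x" for x r
    using cont[OF that] by (rule continuous_on_subset) auto
  have J: "continuous_on {0..} (J x)" if x: "continuous_on {0..} x" for x
  proof -
    have J: "continuous_on {0..r} (J x)" for r
      unfolding J_def
      by (intro continuous_intros indefinite_integral_continuous_1 integrable_continuous_real N x)
    have "continuous (at r within {0..}) (J x)" if "r \<ge> 0" for r
    proof -
      have "continuous (at r within {0..r + 1}) (J x)"
        using J[of "r + 1"] that by (simp add: continuous_on_eq_continuous_within)
      moreover have "at r within {0..} = at r within {0..r + 1}"
        by (rule at_within_nhd[of r "{..<r + 1}"]) auto
      ultimately show ?thesis by simp
    qed
    then show ?thesis by (simp add: continuous_on_eq_continuous_within)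
  qed
  have "T \<Phi> \<in> bcontfun" for \<Phi>
  proof (rule bcontfun_normI)
    have "continuous_on UNIV (\<lambda>r. J (U \<Phi>) (max 0 r))"
      by (rule continuous_on_compose2[OF J[OF U]]) (auto intro!: continuous_intros)
    then show "continuous_on UNIV (T \<Phi>)"
      unfolding T_def by (intro continuous_intros)
    fix r :: real
    define q where "q = max 0 r"
    have "q \<ge> 0" by (simp add: q_def)
    have "0 \<le> \<bar>N (U \<Phi>) 0\<bar>" by simp
    also have "\<dots> \<le> B" using bound[OF U] by simp
    finally have "B \<ge> 0" .
    have "\<bar>integral {0..q} (N (U \<Phi>))\<bar> \<le> integral {0..q} (\<lambda>_. B)"
      by (rule abs_integral_le) (auto intro!: N U bound)
    then have "\<bar>J (U \<Phi>) q\<bar> \<le> \<bar>\<eta>\<bar> + B * q"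
      using \<open>q \<ge> 0\<close> by (simp add: J_def mult.commute)
    \<comment> \<open>The bound grows linearly in \<open>q\<close>; the weight absorbs this growth,
      which is what makes \<open>T \<Phi>\<close> bounded.\<close>
    also have "\<dots> \<le> (\<bar>\<eta>\<bar> + B / K) * exp (K * q)"
    proof -
      have "\<bar>\<eta>\<bar> * 1 \<le> \<bar>\<eta>\<bar> * exp (K * q)"
        using \<open>K > 0\<close> \<open>q \<ge> 0\<close> by (intro mult_left_mono) auto
      moreover have "(B / K) * (K * q) \<le> (B / K) * exp (K * q)"
        using \<open>K > 0\<close> \<open>B \<ge> 0\<close> exp_ge_add_one_self[of "K * q"]
        by (intro mult_left_mono) (linarith, simp)
      ultimately show ?thesis using \<open>K > 0\<close> by (simp add: algebra_simps)
    qed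
    finally have "exp (- K * q) * \<bar>J (U \<Phi>) q\<bar> \<le> exp (- K * q) * ((\<bar>\<eta>\<bar> + B / K) * exp (K * q))"
      by (intro mult_left_mono) auto
    also have "\<dots> = \<bar>\<eta>\<bar> + B / K"
      by (simp add: exp_minus)
    finally show "norm (T \<Phi> r) \<le> \<bar>\<eta>\<bar> + B / K"
      by (simp add: T_def q_def abs_mult)
  qed
  then have T: "apply_bcontfun (Bcontfun (T \<Phi>)) = T \<Phi>" for \<Phi>
    by (simp add: Bcontfun_inverse)
  have "dist (T \<Phi> r) (T \<Psi> r) \<le> 1 / 2 * dist \<Phi> \<Psi>" for \<Phi> \<Psi> r
  proof -
    define q where "q = max 0 r"
    have "q \<ge> 0" by (simp add: q_def)
    define d where "d = dist \<Phi> \<Psi>"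
    have d: "\<bar>apply_bcontfun \<Phi> s - apply_bcontfun \<Psi> s\<bar> \<le> d" for s
      using dist_bounded[of \<Phi> s \<Psi>] by (simp add: dist_real_def d_def)
    have "d \<ge> 0" by (simp add: d_def)
    \<comment> \<open>Causality: \<open>N x s\<close> depends on \<open>x\<close> only through
      \<open>{0..s}\<close>, where the increasing weight is at most
      \<open>exp (K * s)\<close>.\<close>
    have *: "\<bar>N (U \<Phi>) s - N (U \<Psi>) s\<bar> \<le> L * (exp (K * s) * d)" if "s \<in> {0..q}" for s
    proof (rule lip)
      fix t assume "t \<in> {0..s}"
      have "\<bar>U \<Phi> t - U \<Psi> t\<bar> = exp (K * t) * \<bar>apply_bcontfun \<Phi> t - apply_bcontfun \<Psi> t\<bar>"
        by (simp add: U_def abs_mult flip: right_diff_distrib)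
      also have "\<dots> \<le> exp (K * s) * d"
        using d \<open>d \<ge> 0\<close> \<open>t \<in> _\<close> \<open>K > 0\<close> by (intro mult_mono) auto
      finally show "\<bar>U \<Phi> t - U \<Psi> t\<bar> \<le> exp (K * s) * d" .
    qed (use that U in auto)
    have "J (U \<Phi>) q - J (U \<Psi>) q = integral {0..q} (\<lambda>s. N (U \<Phi>) s - N (U \<Psi>) s)"
      unfolding J_def by (subst integral_diff) (auto intro!: integrable_continuous_real N U)
    also have "\<bar>\<dots>\<bar> \<le> integral {0..q} (\<lambda>s. L * d * exp (K * s))"
    proof (rule abs_integral_le)
      show "continuous_on {0..q} (\<lambda>s. N (U \<Phi>) s - N (U \<Psi>) s)"
        by (intro continuous_on_diff N U)
    qed (use * in \<open>auto intro!: continuous_intros simp: mult_ac\<close>)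
    also have "\<dots> = d / 2 * (exp (K * q) - 1)"
      using \<open>K > 0\<close> \<open>q \<ge> 0\<close> by (simp add: integral_exp_mult) (simp add: K_def field_simps)
    also have "\<dots> \<le> d / 2 * exp (K * q)"
      using \<open>d \<ge> 0\<close> by (intro mult_left_mono) auto
    finally have "exp (- K * q) * \<bar>J (U \<Phi>) q - J (U \<Psi>) q\<bar> \<le> exp (- K * q) * (d / 2 * exp (K * q))"
      by (intro mult_left_mono) auto
    also have "\<dots> = d / 2" by (simp add: exp_minus)
    finally show ?thesis
      by (simp add: T_def dist_real_def d_def[symmetric] q_def[symmetric] abs_mult flip: right_diff_distrib)
  qed
  then have "\<exists>!\<Phi>. Bcontfun (T \<Phi>) = \<Phi>"
    by (intro banach_fix_type[of "1 / 2"] allI dist_bound) (simp_all add: T)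
  then obtain \<Phi> where "Bcontfun (T \<Phi>) = \<Phi>" by blast
  then have \<Phi>: "apply_bcontfun \<Phi> = T \<Phi>" using T[of \<Phi>] by simp
  have "U \<Phi> r = J (U \<Phi>) r" if "r \<ge> 0" for r
  proof -
    have "U \<Phi> r = exp (K * r) * T \<Phi> r" by (simp add: U_def flip: \<Phi>)
    also have "\<dots> = J (U \<Phi>) r" using that by (simp add: T_def exp_minus)
    finally show ?thesis .
  qed
  then show ?thesis using U by (auto simp: J_def)
qed


lemma has_real_derivative_integral_Ici:
  fixes f :: "real \<Rightarrow> real"
  assumes "continuous_on {0..} f" "r > 0"
  shows "((\<lambda>r. integral {0..r} f) has_real_derivative f r) (at r)"
proof -
  have "((\<lambda>r. integral {0..r} f) has_real_derivative f r) (at r within {0..r + 1})"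
    using assms by (intro integral_has_real_derivative continuous_on_subset[OF assms(1)]) auto
  moreover have "at r within {0..r + 1} = at r"
    using \<open>r > 0\<close> by (intro at_within_interior) auto
  ultimately show ?thesis by simp
qed

text \<open>The system \<open>Y' = Z\<close>, \<open>r Z' = G(r, Y) - \<beta> Z\<close> has a regular singular point at \<open>r = 0\<close>;
  the representation of \<open>Z\<close> selects its solution that is bounded there.\<close>

lemma regular_singular_exists:
  fixes G :: "real \<Rightarrow> real \<Rightarrow> real"
  assumes G: "continuous_on ({0..} \<times> UNIV) (\<lambda>(s, y). G s y)"
    and bound: "\<And>s y. 0 \<le> s \<Longrightarrow> \<bar>G s y\<bar> \<le> B"
    and "L > 0"
    and lip: "\<And>s y z. 0 \<le> s \<Longrightarrow> \<bar>G s y - G s z\<bar> \<le> L * \<bar>y - z\<bar>"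
    and "\<beta> > 1"
  obtains Y Z where "continuous_on {0..} Y" and "continuous_on {0..} Z" and "Y 0 = \<eta>"
    and "\<And>r. r > 0 \<Longrightarrow> (Y has_real_derivative Z r) (at r)"
    and "\<And>r. r > 0 \<Longrightarrow> (Z has_real_derivative (G r (Y r) - \<beta> * Z r) / r) (at r)"
    and "\<And>r. r \<ge> 0 \<Longrightarrow> Z r = integral {0..1} (\<lambda>q. q powr (\<beta> - 1) * G (r * q) (Y (r * q)))"
proof -
  \<comment> \<open>By \<open>(r powr \<beta> * Z)' = r powr (\<beta> - 1) * G\<close>, the solution
    bounded at 0 is \<open>r powr (- \<beta>)\<close> times the integral of the right-hand side over
    \<open>{0..r}\<close>. Scaling the integration variable by \<open>r\<close> gives this form,
    which makes sense at \<open>r = 0\<close> too, and the system becomes the Volterra equation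
    \<open>Y' = N Y\<close>.\<close>
  define N where "N x r = integral {0..1} (\<lambda>q. q powr (\<beta> - 1) * G (r * q) (x (r * q)))" for x r
  have *: "continuous_on S (\<lambda>p. G (h p) (x (h p)))"
    if "continuous_on {0..} x" "continuous_on S h" "\<And>p. p \<in> S \<Longrightarrow> 0 \<le> h p"
    for x h and S :: "'a::topological_space set"
  proof -
    have "continuous_on S (\<lambda>p. x (h p))"
      by (rule continuous_on_compose2[OF that(1,2)]) (use that(3) in auto)
    then have "continuous_on S (\<lambda>p. (h p, x (h p)))"
      by (intro continuous_intros that)
    from continuous_on_compose2[OF G this] show ?thesis using that(3) by (auto simp: image_subset_iff)
  qed
  have pw: "continuous_on S (\<lambda>p. h p powr (\<beta> - 1))"
    if "continuous_on S h" "\<And>p. p \<in> S \<Longrightarrow> 0 \<le> h p"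
    for h and S :: "'a::topological_space set"
    using that \<open>\<beta> > 1\<close> by (intro continuous_on_powr' continuous_intros) auto
  have pw1: "q powr (\<beta> - 1) \<le> 1" if "q \<in> {0..1}" for q :: real
    using that \<open>\<beta> > 1\<close> by (intro powr_le1) auto
  have integrand: "continuous_on {0..1} (\<lambda>q. q powr (\<beta> - 1) * G (r * q) (x (r * q)))"
    if "continuous_on {0..} x" "r \<ge> 0" for x r
    using that by (intro continuous_on_mult pw * continuous_intros) auto
  have N_cont: "continuous_on {0..} (N x)" if "continuous_on {0..} x" for x
  proof -
    have "continuous_on ({0..} \<times> cbox 0 1)
      (\<lambda>p. snd p powr (\<beta> - 1) * G (fst p * snd p) (x (fst p * snd p)))"
      using that by (intro continuous_on_mult pw * continuous_intros) auto
    then show ?thesis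
      unfolding N_def
      using integral_continuous_on_param[of "{0..}" 0 1
          "\<lambda>r q. q powr (\<beta> - 1) * G (r * q) (x (r * q))"]
      by (simp add: case_prod_beta)
  qed
  have N_bound: "\<bar>N x r\<bar> \<le> B" if "continuous_on {0..} x" "0 \<le> r" for x r
  proof -
    have "\<bar>N x r\<bar> \<le> integral {0..1::real} (\<lambda>_. B)"
      unfolding N_def
    proof (rule abs_integral_le[OF integrand[OF that]])
      fix q :: real assume "q \<in> {0..1}"
      then have "q powr (\<beta> - 1) * \<bar>G (r * q) (x (r * q))\<bar> \<le> 1 * B"
        using pw1 that by (intro mult_mono bound) auto
      then show "\<bar>q powr (\<beta> - 1) * G (r * q) (x (r * q))\<bar> \<le> B"
        by (simp add: abs_mult)
    qed simp
    then show ?thesis by simp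
  qed
  have N_lip: "\<bar>N x r - N y r\<bar> \<le> L * d"
    if xy: "continuous_on {0..} x" "continuous_on {0..} y" "0 \<le> r"
      and d: "\<And>s. s \<in> {0..r} \<Longrightarrow> \<bar>x s - y s\<bar> \<le> d" for x y r d
  proof -
    have "0 \<le> \<bar>x 0 - y 0\<bar>" by simp
    also have "\<dots> \<le> d" using d that by simp
    finally have "d \<ge> 0" .
    have "N x r - N y r = integral {0..1} (\<lambda>q. q powr (\<beta> - 1) * G (r * q) (x (r * q)) -
        q powr (\<beta> - 1) * G (r * q) (y (r * q)))"
      unfolding N_def
      by (subst integral_diff) (auto intro!: integrable_continuous_real integrand xy)
    also have "\<bar>\<dots>\<bar> \<le> integral {0..1::real} (\<lambda>_. L * d)"
    proof (rule abs_integral_le)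
      fix q :: real assume q: "q \<in> {0..1}"
      then have "r * q \<in> {0..r}" using \<open>0 \<le> r\<close> by (auto intro: mult_left_le)
      then have "\<bar>G (r * q) (x (r * q)) - G (r * q) (y (r * q))\<bar> \<le> L * d"
        using lip[of "r * q" "x (r * q)" "y (r * q)"] d[of "r * q"] \<open>L > 0\<close>
        by (meson atLeastAtMost_iff mult_left_mono less_imp_le order_trans)
      then have "q powr (\<beta> - 1) * \<bar>G (r * q) (x (r * q)) - G (r * q) (y (r * q))\<bar> \<le> 1 * (L * d)"
        using pw1[OF q] by (intro mult_mono) auto
      then show "\<bar>q powr (\<beta> - 1) * G (r * q) (x (r * q)) -
        q powr (\<beta> - 1) * G (r * q) (y (r * q))\<bar> \<le> L * d"
        by (simp add: abs_mult flip: right_diff_distrib)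
    qed (auto intro!: continuous_on_diff integrand xy)
    finally show ?thesis by simp
  qed
  obtain Y where Y: "continuous_on {0..} Y"
    and Y_eq: "\<And>r. r \<ge> 0 \<Longrightarrow> Y r = \<eta> + integral {0..r} (N Y)"
    using volterra_exists[of N B L \<eta>, OF N_cont N_bound \<open>L > 0\<close> N_lip] by blast
  define I where "I r = integral {0..r} (\<lambda>s. s powr (\<beta> - 1) * G s (Y s))" for r
  have I_cont: "continuous_on {0..} (\<lambda>s. s powr (\<beta> - 1) * G s (Y s))"
    using Y by (intro continuous_on_mult pw * continuous_intros) auto
  \<comment> \<open>The scaling is undone: now \<open>r\<close> occurs only as a factor and as an
    upper limit, so the product rule applies.\<close>
  have N_eq: "N Y r = r powr (- \<beta>) * I r" if "r > 0" for r
  proof -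
    have "((\<lambda>s. s powr (\<beta> - 1) * G s (Y s)) has_integral I r) {0..r}"
      unfolding I_def
      by (intro integrable_integral integrable_continuous_real continuous_on_subset[OF I_cont]) auto
    from has_integral_stretch_real[OF this, of r] \<open>r > 0\<close>
    have "((\<lambda>q. (r * q) powr (\<beta> - 1) * G (r * q) (Y (r * q))) has_integral I r / r) {0..1}"
      by simp
    from has_integral_mult_right[OF this, of "r powr (1 - \<beta>)"]
    have "((\<lambda>q. q powr (\<beta> - 1) * G (r * q) (Y (r * q))) has_integral r powr (1 - \<beta>) * (I r / r)) {0..1}"
      by (rule has_integral_eq[rotated])
         (use \<open>r > 0\<close> in \<open>auto simp: powr_mult powr_diff field_simps\<close>)
    moreover have "r powr (1 - \<beta>) * (I r / r) = r powr (- \<beta>) * I r"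
      using \<open>r > 0\<close> by (simp add: powr_diff powr_minus field_simps)
    ultimately show ?thesis by (simp add: N_def integral_unique)
  qed
  have "(Y has_real_derivative N Y r) (at r)" if "r > 0" for r
  proof -
    have "((\<lambda>r. \<eta> + integral {0..r} (N Y)) has_real_derivative N Y r) (at r)"
      using has_real_derivative_integral_Ici[OF N_cont[OF Y] that]
      by (auto intro!: derivative_eq_intros)
    then show ?thesis
      by (rule has_field_derivative_transform_within_open[where S = "{0<..}"])
         (use that Y_eq in auto)
  qed
  moreover have "(N Y has_real_derivative (G r (Y r) - \<beta> * N Y r) / r) (at r)" if "r > 0" for r
  proof -
    have "((\<lambda>r. r powr (- \<beta>) * I r) has_real_derivative
        (- \<beta> * r powr (- \<beta> - 1)) * I r + (r powr (\<beta> - 1) * G r (Y r)) * r powr (- \<beta>)) (at r)"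
      using that unfolding I_def
      by (intro DERIV_mult has_real_derivative_powr has_real_derivative_integral_Ici I_cont) auto
    also have "(- \<beta> * r powr (- \<beta> - 1)) * I r + (r powr (\<beta> - 1) * G r (Y r)) * r powr (- \<beta>) =
        (G r (Y r) - \<beta> * N Y r) / r"
      using that by (simp add: N_eq powr_diff powr_minus field_simps)
    finally show ?thesis
      by (rule has_field_derivative_transform_within_open[where S = "{0<..}"])
         (use that N_eq in auto)
  qed
  moreover have "Y 0 = \<eta>" using Y_eq[of 0] by simp
  ultimately show thesis using that[of Y "N Y"] Y N_cont[OF Y] by (simp add: N_def)
qed

section \<open>The unstable manifold of the saddle\<close>

text \<open>The slope of \<open>m (s * y)\<close> in \<open>y\<close> grows with \<open>s\<close>,
  but one constant must serve all \<open>s\<close>. A factor \<open>y\<close> of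
  \<open>y\<^sup>2\<close> absorbs \<open>s\<close>: where the clamp is inactive,
  \<open>s * y \<le> b\<close>, and beyond it nothing varies.\<close>

lemma clamped_product_lipschitz:
  fixes m :: "real \<Rightarrow> real"
  assumes nonneg: "\<And>x. x \<in> {0..b} \<Longrightarrow> 0 \<le> m x"
    and lip: "\<And>x y. x \<in> {0..b} \<Longrightarrow> y \<in> {0..b} \<Longrightarrow> \<bar>m x - m y\<bar> \<le> C * \<bar>x - y\<bar>"
    and M: "\<And>x. x \<in> {0..b} \<Longrightarrow> m x \<le> M"
    and "0 \<le> b" "0 \<le> C" "0 \<le> s" "y \<in> {0..1}" "z \<in> {0..1}"
  shows "\<bar>y\<^sup>2 * m (min (s * y) b) - z\<^sup>2 * m (min (s * z) b)\<bar> \<le> (2 * M + C * b) * \<bar>y - z\<bar>"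
  using \<open>y \<in> {0..1}\<close> \<open>z \<in> {0..1}\<close>
proof (induction y z rule: linorder_wlog)
  case (le y z)
  let ?y = "min (s * y) b" and ?z = "min (s * z) b"
  have yz: "?y \<in> {0..b}" "?z \<in> {0..b}" using le \<open>0 \<le> s\<close> \<open>0 \<le> b\<close> by auto
  have "s * y \<le> s * z" using le \<open>0 \<le> s\<close> by (intro mult_left_mono) auto
  then have "?y \<le> ?z" by auto
  have "y * (?z - ?y) \<le> b * (z - y)"
  proof (cases "s * y \<le> b")
    case True
    have "y * (?z - ?y) \<le> y * (s * z - s * y)"
      using le True by (intro mult_left_mono) auto
    also have "\<dots> = (s * y) * (z - y)" by algebra
    also have "\<dots> \<le> b * (z - y)" using le True by (intro mult_right_mono) auto
    finally show ?thesis .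
  next
    case False
    with \<open>s * y \<le> s * z\<close> have "?z - ?y = 0" by auto
    then show ?thesis using le \<open>0 \<le> b\<close> by simp
  qed
  then have "y * (y * (?z - ?y)) \<le> 1 * (b * (z - y))"
    by (rule mult_mono[rotated]) (use le \<open>?y \<le> ?z\<close> in auto)
  then have "C * (y\<^sup>2 * (?z - ?y)) \<le> C * (b * (z - y))"
    using \<open>0 \<le> C\<close> by (intro mult_left_mono) (auto simp: power2_eq_square mult.assoc)
  moreover have "y\<^sup>2 * \<bar>m ?y - m ?z\<bar> \<le> y\<^sup>2 * (C * \<bar>?y - ?z\<bar>)"
    by (intro mult_left_mono lip yz) auto
  moreover have "\<bar>?y - ?z\<bar> = ?z - ?y" using \<open>?y \<le> ?z\<close> by simp
  ultimately have 1: "y\<^sup>2 * \<bar>m ?y - m ?z\<bar> \<le> C * b * (z - y)"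
    by (simp only: mult.assoc mult.left_commute[of C])
  have "(z\<^sup>2 - y\<^sup>2) * m ?z = (z - y) * ((z + y) * m ?z)" by algebra
  also have "\<dots> \<le> (z - y) * (2 * M)"
    using le M[OF yz(2)] nonneg[OF yz(2)] by (intro mult_left_mono mult_mono) auto
  finally have 2: "(z\<^sup>2 - y\<^sup>2) * m ?z \<le> 2 * M * (z - y)" by (simp add: mult_ac)
  have 3: "0 \<le> (z\<^sup>2 - y\<^sup>2) * m ?z"
    using le nonneg[OF yz(2)] by (intro mult_nonneg_nonneg) (auto simp: power_mono)
  have "y\<^sup>2 * m ?y - z\<^sup>2 * m ?z = y\<^sup>2 * (m ?y - m ?z) - (z\<^sup>2 - y\<^sup>2) * m ?z" by algebra
  also have "\<bar>\<dots>\<bar> \<le> \<bar>y\<^sup>2 * (m ?y - m ?z)\<bar> + \<bar>(z\<^sup>2 - y\<^sup>2) * m ?z\<bar>" by (rule abs_triangle_ineq4)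
  also have "\<dots> \<le> C * b * (z - y) + 2 * M * (z - y)"
    unfolding abs_of_nonneg[OF 3] using 1 2 by (simp add: abs_mult)
  also have "\<dots> = (2 * M + C * b) * \<bar>y - z\<bar>" using le by (simp add: algebra_simps)
  finally show ?case .
next
  case (sym y z)
  then show ?case by (simp add: abs_minus_commute)
qed

text \<open>The substitution \<open>x = r Y(r)\<close>, \<open>r = exp (l t)\<close>, where \<open>l\<close> is the positive eigenvalue,
  turns the equation into one with a regular singular point; the factor \<open>Y\<close> decreases from
  \<open>Y(0) = 1\<close>, so clamping it to \<open>{0..1}\<close> only affects negative values.\<close>

lemma unstable_manifold_exists:
  fixes m :: "real \<Rightarrow> real"
  assumes "\<mu> > 0" "k \<ge> 0" "b > 0"
    and nonneg: "\<And>x. x \<in> {0..b} \<Longrightarrow> 0 \<le> m x"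
    and lip: "\<And>x y. x \<in> {0..b} \<Longrightarrow> y \<in> {0..b} \<Longrightarrow> \<bar>m x - m y\<bar> \<le> C * \<bar>x - y\<bar>"
  shows "\<exists>x p. (\<forall>t. (x has_real_derivative p t) (at t) \<and>
      (p has_real_derivative
        \<mu> * x t - k * p t - (max 0 (x t))\<^sup>2 * m (min (max 0 (x t)) b)) (at t)) \<and>
    (x \<longlongrightarrow> 0) at_bot \<and> (p \<longlongrightarrow> 0) at_bot \<and> (\<forall>\<^sub>F t in at_bot. 0 < x t)"
proof -
  define l where "l = (sqrt (k\<^sup>2 + 4 * \<mu>) - k) / 2"
  have "sqrt (k\<^sup>2) < sqrt (k\<^sup>2 + 4 * \<mu>)" using \<open>\<mu> > 0\<close> by (subst real_sqrt_less_iff) auto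
  then have "l > 0" using \<open>k \<ge> 0\<close> by (simp add: l_def)
  have "(2 * l + k)\<^sup>2 = k\<^sup>2 + 4 * \<mu>" 
  proof -
    have "2 * l + k = sqrt (k\<^sup>2 + 4 * \<mu>)" by (simp add: l_def field_simps)
    then show ?thesis using \<open>\<mu> > 0\<close> by simp
  qed
  then have l: "l\<^sup>2 + k * l = \<mu>" by (simp add: power2_eq_square algebra_simps)
  \<comment> \<open>Inserting \<open>x = r * Y r\<close> with \<open>d/dt = l * r * d/dr\<close>
    into the equation leaves \<open>r * Z' + (3 + k / l) * Z = G\<close>; the multiples of
    \<open>Y\<close> cancel by \<open>l\<^sup>2 + k * l = \<mu>\<close>.\<close>
  define \<beta> where "\<beta> = 3 + k / l"
  have "\<beta> > 1" using \<open>l > 0\<close> \<open>k \<ge> 0\<close> by (simp add: \<beta>_def add_pos_nonneg)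
  have "0 \<le> \<bar>m 0 - m b\<bar>" by simp
  also have "\<dots> \<le> C * b" using lip[of 0 b] \<open>b > 0\<close> by simp
  finally have "C \<ge> 0" using \<open>b > 0\<close> by (simp add: zero_le_mult_iff)
  define M where "M = m 0 + C * b"
  have M: "m x \<le> M" if "x \<in> {0..b}" for x
  proof -
    have "m x \<le> m 0 + C * x" using lip[of x 0] that by (simp add: abs_if split: if_splits)
    also have "C * x \<le> C * b" using that \<open>C \<ge> 0\<close> by (intro mult_left_mono) auto
    finally show ?thesis by (simp add: M_def)
  qed
  have "M \<ge> 0" using nonneg[of 0] \<open>C \<ge> 0\<close> \<open>b > 0\<close> by (simp add: M_def)
  define cl :: "real \<Rightarrow> real" where "cl y = max 0 (min y 1)" for y
  have cl: "cl y \<in> {0..1}" for y by (simp add: cl_def)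
  define G where "G s y = - ((cl y)\<^sup>2 * m (min (s * cl y) b)) / l\<^sup>2" for s y
  have dom: "min (s * cl y) b \<in> {0..b}" if "0 \<le> s" for s y
    using that cl[of y] \<open>b > 0\<close> by auto
  have m_cont: "continuous_on {0..b} m"
    using lip \<open>C \<ge> 0\<close> by (intro lipschitz_on_continuous_on[of C])
      (auto simp: lipschitz_on_def dist_real_def)
  have cl_cont: "continuous_on ({0..} \<times> UNIV) (\<lambda>p. cl (snd p))"
    unfolding cl_def by (intro continuous_intros)
  have "continuous_on ({0..} \<times> UNIV) (\<lambda>p. m (min (fst p * cl (snd p)) b))"
  proof (rule continuous_on_compose2[OF m_cont])
    show "continuous_on ({0..} \<times> UNIV) (\<lambda>p. min (fst p * cl (snd p)) b)"
      by (intro continuous_intros cl_cont)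
  qed (use dom in auto)
  then have G_cont: "continuous_on ({0..} \<times> UNIV) (\<lambda>(s, y). G s y)"
    unfolding G_def case_prod_beta using \<open>l > 0\<close>
    by (intro continuous_on_divide continuous_on_minus continuous_on_mult continuous_on_power
        continuous_on_const cl_cont) auto
  have G_bound: "\<bar>G s y\<bar> \<le> M / l\<^sup>2" if "0 \<le> s" for s y
  proof -
    have "(cl y)\<^sup>2 * m (min (s * cl y) b) \<le> 1 * M"
      using cl[of y] M[OF dom[OF that]] nonneg[OF dom[OF that]] \<open>M \<ge> 0\<close>
      by (intro mult_mono) (auto simp: power_le_one)
    then show ?thesis
      using nonneg[OF dom[OF that, of y]] \<open>l > 0\<close>
      by (simp add: G_def divide_right_mono)
  qed
  have G_nonpos: "G s y \<le> 0" if "0 \<le> s" for s y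
    using nonneg[OF dom[OF that]] by (simp add: G_def)
  define L where "L = (2 * M + C * b) / l\<^sup>2 + 1"
  have "L > 0" using \<open>M \<ge> 0\<close> \<open>C \<ge> 0\<close> \<open>b > 0\<close> by (simp add: L_def add_nonneg_pos)
  have G_lip: "\<bar>G s y - G s z\<bar> \<le> L * \<bar>y - z\<bar>" if "0 \<le> s" for s y z
  proof -
    have "\<bar>G s y - G s z\<bar> =
        \<bar>(cl y)\<^sup>2 * m (min (s * cl y) b) - (cl z)\<^sup>2 * m (min (s * cl z) b)\<bar> / l\<^sup>2"
      unfolding G_def minus_divide_left[symmetric] minus_diff_minus diff_divide_distrib[symmetric]
        abs_minus_cancel abs_divide by simp
    also have "\<dots> \<le> (2 * M + C * b) * \<bar>cl y - cl z\<bar> / l\<^sup>2"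
      using \<open>b > 0\<close> \<open>C \<ge> 0\<close> that
      by (intro divide_right_mono clamped_product_lipschitz nonneg lip M cl) auto
    also have "\<dots> = (2 * M + C * b) / l\<^sup>2 * \<bar>cl y - cl z\<bar>" by simp
    also have "\<dots> \<le> L * \<bar>y - z\<bar>"
      using \<open>M \<ge> 0\<close> \<open>C \<ge> 0\<close> \<open>b > 0\<close> by (intro mult_mono) (auto simp: L_def cl_def)
    finally show ?thesis .
  qed
  obtain Y Z where Y: "continuous_on {0..} Y" and Z: "continuous_on {0..} Z" and "Y 0 = 1"
    and dY: "\<And>r. r > 0 \<Longrightarrow> (Y has_real_derivative Z r) (at r)"
    and dZ: "\<And>r. r > 0 \<Longrightarrow> (Z has_real_derivative (G r (Y r) - \<beta> * Z r) / r) (at r)"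
    and Z_eq: "\<And>r. r \<ge> 0 \<Longrightarrow> Z r = integral {0..1} (\<lambda>q. q powr (\<beta> - 1) * G (r * q) (Y (r * q)))"
    by (rule regular_singular_exists[OF G_cont G_bound \<open>L > 0\<close> G_lip \<open>\<beta> > 1\<close>, where \<eta> = 1])
      (assumption | rule that)+
  have Z_nonpos: "Z r \<le> 0" if "r \<ge> 0" for r
  proof -
    define h where "h = (\<lambda>q. q powr (\<beta> - 1) * G (r * q) (Y (r * q)))"
    have "h q \<le> 0" if "q \<in> {0..1}" for q
      using that \<open>r \<ge> 0\<close> unfolding h_def by (intro mult_nonneg_nonpos G_nonpos) auto
    then have "integral {0..1} h \<le> integral {0..1} (\<lambda>_::real. 0)" if "h integrable_on {0..1}"
      by (intro integral_le that) auto
    \<comment> \<open>A non-integrable function has integral 0 by convention, so the sign holds in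
      either case.\<close>
    then have "integral {0..1} h \<le> 0"
      by (cases "h integrable_on {0..1}") (auto simp: not_integrable_integral)
    then show ?thesis using that by (simp add: Z_eq h_def)
  qed
  have Y_le: "Y r \<le> 1" if "r \<ge> 0" for r
  proof -
    have "Y r \<le> Y 0"
    proof (rule DERIV_nonpos_imp_decreasing_open[OF that])
      show "continuous_on {0..r} Y" using Y by (rule continuous_on_subset) auto
    qed (use dY Z_nonpos in \<open>blast intro: less_imp_le\<close>)
    then show ?thesis using \<open>Y 0 = 1\<close> by simp
  qed
  \<comment> \<open>Back to \<open>x = r * Y r\<close>: the upper clamp is inactive since
    \<open>Y r \<le> 1\<close>, and the lower one becomes \<open>max 0 x\<close>.\<close>
  have G_eq: "r\<^sup>2 * G r (Y r) = - ((max 0 (r * Y r))\<^sup>2 * m (min (max 0 (r * Y r)) b)) / l\<^sup>2"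
    if "r \<ge> 0" for r
  proof -
    have "max 0 (r * Y r) = r * cl (Y r)"
    proof (cases "Y r \<ge> 0")
      case True
      then show ?thesis using Y_le[OF that] that by (simp add: cl_def)
    next
      case False
      then have "r * Y r \<le> 0" using that by (intro mult_nonneg_nonpos) auto
      then show ?thesis using False by (simp add: cl_def)
    qed
    then show ?thesis by (simp add: G_def power_mult_distrib)
  qed
  define e where "e t = exp (l * t)" for t
  have e: "e t > 0" "(e has_real_derivative l * e t) (at t)" for t
    unfolding e_def by (auto intro!: derivative_eq_intros)
  \<comment> \<open>The limit is taken within \<open>{0..}\<close> because \<open>Y\<close> and
    \<open>Z\<close> are known to be continuous at 0 only from the right.\<close>
  have e_lim: "filterlim e (at 0 within {0..}) at_bot"
  proof -
    have "filterlim (\<lambda>t. l * t) at_bot at_bot"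
      by (rule filterlim_tendsto_pos_mult_at_bot[OF tendsto_const \<open>l > 0\<close> filterlim_ident])
    then have "(e \<longlongrightarrow> 0) at_bot"
      unfolding e_def by (rule filterlim_compose[OF exp_at_bot])
    moreover have "e t \<noteq> 0" "0 \<le> e t" for t using e(1)[of t] by auto
    ultimately show ?thesis by (simp add: filterlim_at)
  qed
  have lim: "((\<lambda>t. f (e t)) \<longlongrightarrow> f 0) at_bot" if "continuous_on {0..} f" for f :: "real \<Rightarrow> real"
    using that by (intro filterlim_compose[OF _ e_lim]) (simp add: continuous_on_def)
  have e0: "(e \<longlongrightarrow> 0) at_bot" using lim[OF continuous_on_id] by simp
  define x where "x t = e t * Y (e t)" for t
  define p where "p t = l * (e t * Y (e t) + (e t)\<^sup>2 * Z (e t))" for t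
  note [derivative_intros] = e(2) DERIV_chain2[OF dY e(2)] DERIV_chain2[OF dZ e(2)]
  have "(x has_real_derivative p t) (at t)" for t
    unfolding x_def p_def
    by (auto intro!: derivative_eq_intros e simp: power2_eq_square algebra_simps)
  moreover have "(p has_real_derivative
      \<mu> * x t - k * p t - (max 0 (x t))\<^sup>2 * m (min (max 0 (x t)) b)) (at t)" for t
  proof -
    let ?r = "e t"
    have "(p has_real_derivative l\<^sup>2 * ?r * Y ?r - l * k * ?r\<^sup>2 * Z ?r + l\<^sup>2 * (?r\<^sup>2 * G ?r (Y ?r))) (at t)"
    proof (rule DERIV_cong)
      show "(p has_real_derivative l * ((l * ?r * Y ?r + Z ?r * (l * ?r) * ?r) +
          (2 * (l * ?r * ?r) * Z ?r + (G ?r (Y ?r) - \<beta> * Z ?r) / ?r * (l * ?r) * ?r\<^sup>2))) (at t)"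
        unfolding p_def
        by (intro DERIV_cmult DERIV_add DERIV_mult e(2) DERIV_chain2[OF dY e(2)] DERIV_chain2[OF dZ e(2)] e(1)
            DERIV_power[OF e(2), where n = 2, simplified, THEN DERIV_cong]) (simp add: mult_ac)
      have "(G ?r (Y ?r) - \<beta> * Z ?r) / ?r * (l * ?r) * ?r\<^sup>2 =
          l * ?r\<^sup>2 * G ?r (Y ?r) - (l * \<beta>) * ?r\<^sup>2 * Z ?r"
      proof -
        have *: "X / ?r * (l * ?r) * ?r\<^sup>2 = l * ?r\<^sup>2 * X" for X using e(1)[of t] by simp
        show ?thesis unfolding * by (simp add: algebra_simps)
      qed
      also have "l * \<beta> = 3 * l + k" using \<open>l > 0\<close> by (simp add: \<beta>_def algebra_simps)
      finally have eq: "(G ?r (Y ?r) - \<beta> * Z ?r) / ?r * (l * ?r) * ?r\<^sup>2 =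
          l * ?r\<^sup>2 * G ?r (Y ?r) - (3 * l + k) * ?r\<^sup>2 * Z ?r" .
      show "l * ((l * ?r * Y ?r + Z ?r * (l * ?r) * ?r) +
          (2 * (l * ?r * ?r) * Z ?r + (G ?r (Y ?r) - \<beta> * Z ?r) / ?r * (l * ?r) * ?r\<^sup>2)) =
          l\<^sup>2 * ?r * Y ?r - l * k * ?r\<^sup>2 * Z ?r + l\<^sup>2 * (?r\<^sup>2 * G ?r (Y ?r))"
        unfolding eq by (simp add: algebra_simps power2_eq_square)
    qed
    moreover have "l\<^sup>2 * (?r\<^sup>2 * G ?r (Y ?r)) = - ((max 0 (x t))\<^sup>2 * m (min (max 0 (x t)) b))"
      using \<open>l > 0\<close> e(1)[of t] by (simp add: G_eq x_def)
    moreover have "l\<^sup>2 * ?r * Y ?r - l * k * ?r\<^sup>2 * Z ?r = \<mu> * x t - k * p t"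
      unfolding l[symmetric] x_def p_def by (simp add: algebra_simps power2_eq_square)
    ultimately show ?thesis by simp
  qed
  moreover have "((\<lambda>t. Y (e t)) \<longlongrightarrow> 1) at_bot" using lim[OF Y] \<open>Y 0 = 1\<close> by simp
  then have "\<forall>\<^sub>F t in at_bot. Y (e t) > 0" by (rule order_tendstoD) simp
  then have "\<forall>\<^sub>F t in at_bot. x t > 0"
    by eventually_elim (simp add: x_def e(1))
  moreover have "(x \<longlongrightarrow> 0) at_bot"
    unfolding x_def using tendsto_mult[OF e0 lim[OF Y]] by simp
  moreover have "(p \<longlongrightarrow> 0) at_bot"
  proof -
    have "(p \<longlongrightarrow> l * (0 * Y 0 + 0\<^sup>2 * Z 0)) at_bot"
      unfolding p_def by (intro tendsto_intros e0 lim[OF Y] lim[OF Z])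
    then show ?thesis by simp
  qed
  ultimately show ?thesis by blast
qed

section \<open>Damped motion in a potential\<close>

lemma antiderivative_exists:
  fixes f :: "real \<Rightarrow> real"
  assumes "continuous_on UNIV f"
  obtains F where "\<And>x. (F has_real_derivative f x) (at x)" and "F 0 = 0"
proof -
  have int: "f integrable_on {a..b}" for a b
    by (intro integrable_continuous_real continuous_on_subset[OF assms]) auto
  \<comment> \<open>At least one of the two intervals is empty or a single point, so this is the
    oriented integral from 0 to \<open>x\<close>.\<close>
  define F where "F x = integral {0..x} f - integral {x..0} f" for x
  have "(F has_real_derivative f x) (at x)" for x
  proof -
    define n where "n = \<bar>x\<bar> + 1"
    have "((\<lambda>u. integral {-n..u} f) has_real_derivative f x) (at x within {-n..n})"
      by (rule integral_has_real_derivative)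
         (auto simp: n_def abs_if intro: continuous_on_subset[OF assms])
    moreover have "at x within {-n..n} = at x"
      by (rule at_within_interior) (auto simp: n_def)
    ultimately have "((\<lambda>u. integral {-n..u} f - integral {-n..0} f) has_real_derivative f x) (at x)"
      by (auto intro!: derivative_eq_intros)
    then show ?thesis
    proof (rule has_field_derivative_transform_within_open[where S = "{-n<..<n}"])
      fix u assume "u \<in> {-n<..<n}"
      then show "integral {-n..u} f - integral {-n..0} f = F u"
        using Henstock_Kurzweil_Integration.integral_combine[OF _ _ int, of "-n" 0 u]
          Henstock_Kurzweil_Integration.integral_combine[OF _ _ int, of "-n" u 0]
        by (cases u "0 :: real" rule: linorder_cases) (auto simp: F_def n_def)
    qed (auto simp: n_def)
  qed
  moreover have "F 0 = 0" by (simp add: F_def)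
  ultimately show thesis by (rule that)
qed

lemma decreasing_bounded_tendsto:
  fixes f :: "real \<Rightarrow> real"
  assumes "\<And>s t. s \<le> t \<Longrightarrow> f t \<le> f s" and "\<And>t. B \<le> f t"
  obtains l where "(f \<longlongrightarrow> l) at_top"
proof
  have bdd: "bdd_below (range f)" using assms(2) by (intro bdd_belowI[of _ B]) auto
  show "(f \<longlongrightarrow> Inf (range f)) at_top"
  proof (rule order_tendstoI)
    fix a assume "a < Inf (range f)"
    then show "\<forall>\<^sub>F t in at_top. a < f t"
      using cInf_lower[OF rangeI bdd] by (intro always_eventually allI) (rule less_le_trans)
  next
    fix a assume "Inf (range f) < a"
    then obtain t0 where "f t0 < a" using cInf_lessD[of "range f" a] by auto
    then show "\<forall>\<^sub>F t in at_top. f t < a"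
      using assms(1) by (intro eventually_at_top_linorderI[of t0]) (meson le_less_trans)
  qed
qed

text \<open>Barbalat's lemma: \<open>\<psi>\<close> is Lipschitz, so a large value of it persists
  for a fixed time and would move \<open>\<phi>\<close> by a fixed amount, against the convergence
  of \<open>\<phi>\<close>.\<close>

lemma derivative_tendsto_0:
  fixes \<phi> \<psi> \<omega> :: "real \<Rightarrow> real"
  assumes \<phi>: "\<And>t. (\<phi> has_real_derivative \<psi> t) (at t)"
    and \<psi>: "\<And>t. (\<psi> has_real_derivative \<omega> t) (at t)"
    and bound: "\<And>t. \<bar>\<omega> t\<bar> \<le> B"
    and lim: "(\<phi> \<longlongrightarrow> l) at_top"
  shows "(\<psi> \<longlongrightarrow> 0) at_top"
proof (rule tendstoI)
  fix e :: real assume "e > 0"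
  have "0 \<le> \<bar>\<omega> 0\<bar>" by simp
  also have "\<dots> \<le> B" by (rule bound)
  finally have "B \<ge> 0" .
  \<comment> \<open>Over a time \<open>h\<close> the function \<open>\<psi>\<close> varies by less
    than \<open>e / 2\<close>, and the tolerance \<open>e * h / 4\<close> for \<open>\<phi>\<close>
    bounds the mean of \<open>\<psi>\<close> over that time by \<open>e / 2\<close>.\<close>
  define h where "h = e / (2 * (B + 1))"
  have "h > 0" "B * h < e / 2"
    using \<open>e > 0\<close> \<open>B \<ge> 0\<close> by (simp_all add: h_def field_simps)
  have "\<forall>\<^sub>F t in at_top. dist (\<phi> t) l < e * h / 4"
    using lim \<open>e > 0\<close> \<open>h > 0\<close> by (intro tendstoD) auto
  then obtain T where T: "\<And>t. t \<ge> T \<Longrightarrow> \<bar>\<phi> t - l\<bar> < e * h / 4"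
    by (auto simp: eventually_at_top_linorder dist_real_def)
  have "\<bar>\<psi> t\<bar> < e" if "t \<ge> T" for t
  proof -
    obtain \<tau> where \<tau>: "t < \<tau>" "\<tau> < t + h" and "\<phi> (t + h) - \<phi> t = (t + h - t) * \<psi> \<tau>"
      using MVT2[of t "t + h" \<phi> \<psi>] \<phi> \<open>h > 0\<close> by auto
    then have "h * \<bar>\<psi> \<tau>\<bar> = \<bar>\<phi> (t + h) - \<phi> t\<bar>" using \<open>h > 0\<close> by (simp add: abs_mult)
    also have "\<dots> < h * (e / 2)"
      using T[OF that] T[of "t + h"] that \<open>h > 0\<close> by (simp add: mult.commute abs_if split: if_splits)
    finally have "\<bar>\<psi> \<tau>\<bar> < e / 2" using \<open>h > 0\<close> by simp
    obtain \<sigma> where "\<psi> \<tau> - \<psi> t = (\<tau> - t) * \<omega> \<sigma>"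
      using MVT2[of t \<tau> \<psi> \<omega>] \<psi> \<tau> by auto
    then have "\<bar>\<psi> \<tau> - \<psi> t\<bar> = (\<tau> - t) * \<bar>\<omega> \<sigma>\<bar>" using \<tau> by (simp add: abs_mult)
    also have "\<dots> \<le> h * B" using \<tau> bound by (intro mult_mono) auto
    finally show ?thesis using \<open>\<bar>\<psi> \<tau>\<bar> < e / 2\<close> \<open>B * h < e / 2\<close> by (simp add: mult.commute)
  qed
  then show "\<forall>\<^sub>F t in at_top. dist (\<psi> t) 0 < e"
    by (auto simp: eventually_at_top_linorder)
qed

lemma damped_energy_derivative:
  fixes x p f F :: "real \<Rightarrow> real"
  assumes "(x has_real_derivative p t) (at t)"
    and "(p has_real_derivative f (x t) - k * p t) (at t)"
    and "(F has_real_derivative f (x t)) (at (x t))"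
  shows "((\<lambda>t. (p t)\<^sup>2 / 2 - F (x t)) has_real_derivative - k * (p t)\<^sup>2) (at t)"
proof -
  have "((\<lambda>t. F (x t)) has_real_derivative f (x t) * p t) (at t)"
    using DERIV_chain2[OF assms(3,1)] .
  then show ?thesis
    by (auto intro!: derivative_eq_intros assms simp: power2_eq_square field_simps)
qed

lemma damped_energy_decreasing:
  fixes x p f F :: "real \<Rightarrow> real"
  assumes "\<And>t. (x has_real_derivative p t) (at t)"
    and "\<And>t. (p has_real_derivative f (x t) - k * p t) (at t)"
    and "\<And>t. (F has_real_derivative f (x t)) (at (x t))"
    and "k > 0" "s \<le> t"
  shows "(p t)\<^sup>2 / 2 - F (x t) \<le> (p s)\<^sup>2 / 2 - F (x s)"
proof (rule DERIV_nonpos_imp_nonincreasing[OF \<open>s \<le> t\<close>])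
  show "\<exists>y. ((\<lambda>t. (p t)\<^sup>2 / 2 - F (x t)) has_real_derivative y) (at r) \<and> y \<le> 0" for r
    using damped_energy_derivative[of x p r f k F, OF assms(1-3)] \<open>k > 0\<close> by (intro exI conjI) auto
qed

text \<open>The energy is nonincreasing with limit 0 in the past, hence never positive. If it were 0
  at \<open>t\<close>, it would be 0 at all earlier times; then friction forces
  \<open>p = 0\<close>, so \<open>x\<close> is constant there and equal to its limit 0, against
  \<open>pos\<close>.\<close>

lemma damped_energy_negative:
  fixes x p f F :: "real \<Rightarrow> real"
  assumes x: "\<And>t. (x has_real_derivative p t) (at t)"
    and p: "\<And>t. (p has_real_derivative f (x t) - k * p t) (at t)"
    and F: "\<And>t. (F has_real_derivative f t) (at t)" and "F 0 = 0" and "k > 0"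
    and x0: "(x \<longlongrightarrow> 0) at_bot" and p0: "(p \<longlongrightarrow> 0) at_bot"
    and pos: "\<forall>\<^sub>F t in at_bot. 0 < x t"
  shows "(p t)\<^sup>2 / 2 < F (x t)"
proof (rule ccontr)
  define E where "E t = (p t)\<^sup>2 / 2 - F (x t)" for t
  have E_dec: "E t \<le> E s" if "s \<le> t" for s t
    unfolding E_def by (rule damped_energy_decreasing[of x p f k F, OF x p F \<open>k > 0\<close> that])
  have "isCont F 0" using F DERIV_isCont by blast
  then have "((\<lambda>t. F (x t)) \<longlongrightarrow> F 0) at_bot" using x0 by (rule isCont_tendsto_compose)
  then have E_lim: "(E \<longlongrightarrow> 0) at_bot"
    unfolding E_def using \<open>F 0 = 0\<close> by (auto intro!: tendsto_eq_intros p0)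
  have E_nonpos: "E s \<le> 0" for s
    by (rule tendsto_lowerbound[OF E_lim])
       (auto simp: eventually_at_bot_linorder intro!: exI[of _ s] E_dec)
  assume "\<not> ?thesis"
  then have E_0: "E s = 0" if "s \<le> t" for s
    using E_dec[OF that] E_nonpos[of s] by (simp add: E_def)
  have p_0: "p s = 0" if "s < t" for s
  proof -
    have "- k * (p s)\<^sup>2 = 0"
    proof (rule DERIV_local_const)
      show "(E has_real_derivative - k * (p s)\<^sup>2) (at s)"
        unfolding E_def by (rule damped_energy_derivative[of x p s f k F, OF x p F])
      show "0 < t - s" using that by simp
      show "\<forall>y. \<bar>s - y\<bar> < t - s \<longrightarrow> E s = E y"
        using that by (auto simp: E_0 abs_less_iff)
    qed
    then show ?thesis using \<open>k > 0\<close> by simp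
  qed
  have x_const: "x s = x (t - 1)" if "s < t - 1" for s
  proof (rule DERIV_isconst_end[OF that, symmetric])
    show "continuous_on {s..t - 1} x"
      using x by (meson DERIV_continuous continuous_at_imp_continuous_on)
    show "(x has_real_derivative 0) (at r)" if "r < t - 1" for r
      using x[of r] p_0[of r] that by simp
  qed
  have "\<forall>\<^sub>F s in at_bot. s < t - 1" by simp
  then have ev: "\<forall>\<^sub>F s in at_bot. x s = x (t - 1)" by eventually_elim (rule x_const)
  then have "(x \<longlongrightarrow> x (t - 1)) at_bot" by (rule tendsto_eventually)
  then have "x (t - 1) = 0" using x0 by (intro tendsto_unique[of at_bot x]) auto
  with ev have "\<forall>\<^sub>F s in at_bot. x s = 0" by simp
  with pos have "\<forall>\<^sub>F s in at_bot. 0 < x s \<and> x s = 0" by (rule eventually_conj)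
  then show False using eventually_happens'[OF trivial_limit_at_bot_linorder] by fastforce
qed

text \<open>The range is connected and contains a point between 0 and \<open>b\<close>; it could
  extend further only through 0 or \<open>b\<close>, where \<open>F\<close> is not positive.\<close>

lemma confined_by_potential:
  fixes x F :: "real \<Rightarrow> real"
  assumes cont: "continuous_on UNIV x" and pos: "\<And>t. F (x t) > 0" and "F 0 \<le> 0" "F b \<le> 0" "b > 0"
    and x0: "(x \<longlongrightarrow> 0) at_bot" and ev: "\<forall>\<^sub>F t in at_bot. 0 < x t"
  shows "0 < x t \<and> x t < b"
proof -
  have "\<forall>\<^sub>F s in at_bot. x s < b" using x0 \<open>b > 0\<close> by (rule order_tendstoD)
  with ev have "\<forall>\<^sub>F s in at_bot. 0 < x s \<and> x s < b" by eventually_elim simp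
  then obtain s where s: "0 < x s" "x s < b" using eventually_happens'[OF trivial_limit_at_bot_linorder] by blast
  have conn: "connected (range x)" using cont by (rule connected_continuous_image) simp
  have "0 \<notin> range x" "b \<notin> range x"
    using pos assms(3,4) by (metis imageE leD)+
  with s connectedD_interval[OF conn, of "x t" "x s" 0] connectedD_interval[OF conn, of "x s" "x t" b]
  show ?thesis by (auto simp: not_less[symmetric])
qed

section \<open>The force, its potential and the equilibrium \<open>u0 c\<close>\<close>

definition force :: "real \<Rightarrow> real \<Rightarrow> real" where
  "force c u = c * u + u / (u - c) - (1 / 2) * u\<^sup>2"

text \<open>The antiderivative of \<open>force c\<close> below \<open>c\<close> that vanishes at 0.
  The logarithm comes from \<open>u / (u - c) = 1 + c / (u - c)\<close>; it makes the function tend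
  to minus infinity at \<open>c\<close>.\<close>

definition potential :: "real \<Rightarrow> real \<Rightarrow> real" where
  "potential c u = c * u\<^sup>2 / 2 + u + c * ln (c - u) - c * ln c - u ^ 3 / 6"

lemma potential_0: "potential c 0 = 0"
  by (simp add: potential_def)

lemma potential_derivative:
  assumes "u < c"
  shows "(potential c has_real_derivative force c u) (at u)"
proof -
  have "(potential c has_real_derivative c * u + 1 - c / (c - u) - u\<^sup>2 / 2) (at u)"
    unfolding potential_def using assms by (auto intro!: derivative_eq_intros simp: power2_eq_square)
  also have "c * u + 1 - c / (c - u) - u\<^sup>2 / 2 = force c u"
    using assms by (simp add: force_def divide_simps) (simp add: algebra_simps)
  finally show ?thesis .
qed

lemma force_derivative:
  assumes "u < c"
  shows "(force c has_real_derivative c - c / (c - u)\<^sup>2 - u) (at u)"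
proof -
  have "(force c has_real_derivative c + ((u - c) - u) / ((u - c) * (u - c)) - u) (at u)"
    unfolding force_def using assms by (auto intro!: derivative_eq_intros)
  also have "(u - c) * (u - c) = (c - u)\<^sup>2" by (simp add: power2_eq_square algebra_simps)
  finally show ?thesis by simp
qed

text \<open>The linear part at 0 is split off. The cofactor of \<open>- u\<^sup>2\<close> is
  nonnegative, which is the shape that \<open>unstable_manifold_exists\<close> requires.\<close>

lemma force_near_0:
  assumes "u < c" "c > 0"
  shows "force c u = (c - 1 / c) * u - u\<^sup>2 * (1 / 2 + 1 / (c * (c - u)))"
  using assms by (simp add: force_def divide_simps) (simp add: power2_eq_square algebra_simps)

lemma u0_bounds:
  assumes "c > 1"
  shows "0 < u0 c" "u0 c < c"
proof -
  have "1 < c * c" using assms less_1_mult by blast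
  have "sqrt (c\<^sup>2 + 8) < sqrt ((3 * c)\<^sup>2)"
    using \<open>1 < c * c\<close> by (subst real_sqrt_less_iff) (simp add: power2_eq_square)
  also have "sqrt ((3 * c)\<^sup>2) = 3 * c" using assms by (intro real_sqrt_unique) auto
  finally show "0 < u0 c" by (simp add: u0_def)
  have "sqrt (c\<^sup>2) < sqrt (c\<^sup>2 + 8)" by (subst real_sqrt_less_iff) simp
  then show "u0 c < c" using assms by (simp add: u0_def)
qed

text \<open>Clearing the denominator leaves \<open>u\<close> times a quadratic with roots
  \<open>u0 c\<close> and \<open>3 * c - u0 c\<close>. For \<open>c > 1\<close> the second root lies
  above \<open>c\<close>, so on \<open>0 < u < c\<close> the force has the sign of
  \<open>u0 c - u\<close>.\<close>

lemma force_factorization: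
  assumes "u < c"
  shows "2 * (c - u) * force c u = u * (u0 c - u) * (3 * c - u0 c - u)"
proof -
  have "u0 c * (3 * c - u0 c) = ((3 * c)\<^sup>2 - (sqrt (c\<^sup>2 + 8))\<^sup>2) / 4"
    by (simp add: u0_def power2_eq_square field_simps)
  also have "\<dots> = 2 * c\<^sup>2 - 2" by (simp add: power_mult_distrib)
  finally have *: "u0 c * (3 * c - u0 c) = 2 * c\<^sup>2 - 2" .
  have "2 * (c - u) * force c u = u * (2 * c\<^sup>2 - 2 - 3 * c * u + u\<^sup>2)"
    using assms by (simp add: force_def divide_simps) (simp add: power2_eq_square algebra_simps)
  also have "\<dots> = u * (u0 c - u) * (3 * c - u0 c - u)"
    unfolding *[symmetric] by (simp add: power2_eq_square algebra_simps)
  finally show ?thesis .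
qed

lemma force_pos:
  assumes "c > 1" "0 < u" "u < u0 c"
  shows "force c u > 0"
proof -
  have "u < c" "u0 c < c" using assms u0_bounds[of c] by auto
  have "0 < u * (u0 c - u) * (3 * c - u0 c - u)"
    using assms \<open>u < c\<close> \<open>u0 c < c\<close> by (intro mult_pos_pos) auto
  then have "0 < 2 * (c - u) * force c u" using force_factorization[OF \<open>u < c\<close>] by simp
  then show ?thesis using \<open>u < c\<close> by (simp add: zero_less_mult_iff)
qed

text \<open>Linearity in \<open>u\<close> is the point: an orbit of negative energy then stays a
  definite distance away from 0. The same bound controls its velocity.\<close>

lemma potential_upper_bound:
  assumes "0 < u" "u < c"
  shows "potential c u \<le> (c\<^sup>2 / 2 + 1) * u"
proof -
  have "c * ln (c - u) \<le> c * ln c" using assms by (intro mult_left_mono) auto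
  moreover have "c * u\<^sup>2 \<le> c * (c * u)"
    using assms by (intro mult_left_mono) (auto simp: power2_eq_square)
  moreover have "0 \<le> u ^ 3" using assms by simp
  moreover have "(c\<^sup>2 / 2 + 1) * u = c * (c * u) / 2 + u"
    by (simp add: power2_eq_square algebra_simps)
  ultimately show ?thesis unfolding potential_def by linarith
qed

lemma potential_negative_near_c:
  assumes "c > 0"
  obtains b where "0 < b" "b < c" "potential c b < 0"
proof
  \<comment> \<open>With \<open>b\<close> as below, the logarithm contributes
    \<open>- c * K\<close>, while the other terms stay below \<open>c * (c\<^sup>2 / 2 + 1)\<close>;
    \<open>K\<close> exceeds this second factor by 1.\<close>
  define K where "K = c\<^sup>2 / 2 + 2"
  define b where "b = c * (1 - exp (- K))"
  have "K > 0" by (simp add: K_def add_nonneg_pos)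
  then show "0 < b" "b < c" using assms by (simp_all add: b_def)
  have "c - b = c * exp (- K)" by (simp add: b_def algebra_simps)
  then have "ln (c - b) = ln c - K" using assms by (simp add: ln_mult)
  then have "c * ln (c - b) = c * ln c - c * K" by (simp add: right_diff_distrib)
  then have "potential c b = c * b\<^sup>2 / 2 + b - c * K - b ^ 3 / 6"
    by (simp add: potential_def)
  also have "\<dots> < c * c\<^sup>2 / 2 + c - c * K"
  proof -
    have "c * b\<^sup>2 \<le> c * c\<^sup>2"
      using \<open>0 < b\<close> \<open>b < c\<close> by (intro mult_left_mono power_mono) auto
    moreover have "0 < b ^ 3" using \<open>0 < b\<close> by simp
    ultimately show ?thesis using \<open>b < c\<close> by linarith
  qed
  also have "\<dots> < 0" using assms by (simp add: K_def algebra_simps)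
  finally show "potential c b < 0" .
qed

section \<open>Convergence to the bottom of the well\<close>

text \<open>The energy is monotone and bounded, hence convergent.
  \<open>derivative_tendsto_0\<close> for the energy gives \<open>p\<close> tending to 0, and for
  \<open>p\<close> it gives the force tending to 0 along the orbit; the bound
  \<open>x t < b < c\<close> keeps the second derivatives bounded. The zero of the force at 0 is
  excluded because the energy stays below a negative value.\<close>

lemma oscillator_tendsto_u0:
  fixes x p :: "real \<Rightarrow> real"
  assumes "a > 0" "k > 0" "c > 1" "b < c"
    and x: "\<And>t. (x has_real_derivative p t) (at t)"
    and p: "\<And>t. (p has_real_derivative a * force c (x t) - k * p t) (at t)"
    and range: "\<And>t. 0 < x t \<and> x t < b"
    and energy: "\<And>t. (p t)\<^sup>2 / 2 < a * potential c (x t)"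
  shows "(x \<longlongrightarrow> u0 c) at_top" and "(p \<longlongrightarrow> 0) at_top"
    and "\<exists>P. \<forall>t. \<bar>p t\<bar> \<le> P"
proof -
  define f where "f u = a * force c u" for u
  define F where "F u = a * potential c u" for u
  have x_lt: "x t < c" and x_pos: "0 < x t" for t using range[of t] \<open>b < c\<close> by auto
  have p': "(p has_real_derivative f (x t) - k * p t) (at t)" for t
    using p by (simp add: f_def)
  have F: "(F has_real_derivative f (x t)) (at (x t))" for t
    unfolding F_def f_def by (intro DERIV_cmult potential_derivative x_lt)
  define E where "E t = (p t)\<^sup>2 / 2 - F (x t)" for t
  have E: "(E has_real_derivative - k * (p t)\<^sup>2) (at t)" for t
    unfolding E_def by (rule damped_energy_derivative[of x p t f k F, OF x p' F])
  have E_dec: "E t \<le> E s" if "s \<le> t" for s t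
    unfolding E_def by (rule damped_energy_decreasing[of x p f k F, OF x p' F \<open>k > 0\<close> that])
  define A where "A = c\<^sup>2 / 2 + 1"
  have "A > 0" by (simp add: A_def add_nonneg_pos)
  have F_le: "F (x t) \<le> a * (A * x t)" for t
    unfolding F_def A_def using \<open>a > 0\<close>
    by (intro mult_left_mono potential_upper_bound x_lt x_pos) auto
  have F_bd: "F (x t) \<le> a * (A * c)" for t
  proof (rule order_trans[OF F_le])
    show "a * (A * x t) \<le> a * (A * c)"
      using \<open>a > 0\<close> \<open>A > 0\<close> x_lt[of t] by (intro mult_left_mono) auto
  qed
  \<comment> \<open>Negative energy means \<open>(p t)\<^sup>2 < 2 * F (x t)\<close>, and
    \<open>F\<close> is at most \<open>a * (A * c)\<close> along the orbit.\<close>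
  define P where "P = sqrt (2 * (a * (A * c)))"
  have p_bd: "\<bar>p t\<bar> \<le> P" for t
    unfolding P_def using energy[of t] F_bd[of t]
    by (intro real_le_rsqrt) (simp add: F_def)
  then show "\<exists>P. \<forall>t. \<bar>p t\<bar> \<le> P" by blast
  have "P \<ge> 0" using p_bd[of 0] by simp
  have f_bd: "\<bar>f (x t)\<bar> \<le> a * (c * c + c / (c - b) + c\<^sup>2)" for t
  proof -
    have "\<bar>force c (x t)\<bar> \<le> \<bar>c * x t\<bar> + \<bar>x t / (x t - c)\<bar> + \<bar>(1 / 2) * (x t)\<^sup>2\<bar>"
      unfolding force_def by linarith
    also have "\<dots> \<le> c * c + c / (c - b) + c\<^sup>2"
    proof (intro add_mono)
      show "\<bar>c * x t\<bar> \<le> c * c" using x_lt[of t] x_pos[of t] by (simp add: abs_mult)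
      show "\<bar>x t / (x t - c)\<bar> \<le> c / (c - b)"
        using x_lt[of t] x_pos[of t] range[of t] \<open>b < c\<close> by (simp add: abs_divide frac_le)
      have "(x t)\<^sup>2 \<le> c\<^sup>2" using x_lt[of t] x_pos[of t] by (intro power_mono) auto
      then show "\<bar>(1 / 2) * (x t)\<^sup>2\<bar> \<le> c\<^sup>2"
        using zero_le_power2[of c] zero_le_power2[of "x t"] by linarith
    qed
    finally show ?thesis using \<open>a > 0\<close> by (simp add: f_def abs_mult)
  qed
  define Q where "Q = a * (c * c + c / (c - b) + c\<^sup>2) + k * P"
  have p'_bd: "\<bar>f (x t) - k * p t\<bar> \<le> Q" for t
  proof -
    have "\<bar>f (x t) - k * p t\<bar> \<le> \<bar>f (x t)\<bar> + k * \<bar>p t\<bar>"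
      using \<open>k > 0\<close> abs_triangle_ineq4[of "f (x t)" "k * p t"] by (simp add: abs_mult)
    also have "\<dots> \<le> Q" unfolding Q_def using f_bd p_bd \<open>k > 0\<close> by (intro add_mono mult_left_mono) auto
    finally show ?thesis .
  qed
  have "Q \<ge> 0" using p'_bd[of 0] by simp
  have "- (a * (A * c)) \<le> E t" for t using F_bd[of t] zero_le_power2[of "p t"] unfolding E_def by linarith
  then obtain l where "(E \<longlongrightarrow> l) at_top" using decreasing_bounded_tendsto[of E] E_dec by blast
  have "((\<lambda>t. - k * (p t)\<^sup>2) \<longlongrightarrow> 0) at_top"
  proof (rule derivative_tendsto_0[OF E _ _ \<open>(E \<longlongrightarrow> l) at_top\<close>])
    show "((\<lambda>t. - k * (p t)\<^sup>2) has_real_derivative - k * (2 * (p t * (f (x t) - k * p t)))) (at t)" for t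
      by (auto intro!: derivative_eq_intros p')
    show "\<bar>- k * (2 * (p t * (f (x t) - k * p t)))\<bar> \<le> k * (2 * (P * Q))" for t
      using \<open>k > 0\<close> p_bd[of t] p'_bd[of t] \<open>P \<ge> 0\<close>
      by (simp add: abs_mult mult_mono)
  qed
  then have "((\<lambda>t. (- 1 / k) * (- k * (p t)\<^sup>2)) \<longlongrightarrow> (- 1 / k) * 0) at_top"
    by (intro tendsto_mult tendsto_const)
  then have "((\<lambda>t. sqrt ((p t)\<^sup>2)) \<longlongrightarrow> sqrt 0) at_top"
    using \<open>k > 0\<close> by (intro tendsto_real_sqrt) simp
  then show p_lim: "(p \<longlongrightarrow> 0) at_top" by (simp add: tendsto_rabs_zero_iff)
  have "((\<lambda>t. f (x t) - k * p t) \<longlongrightarrow> 0) at_top"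
  proof (rule derivative_tendsto_0[OF p' _ _ p_lim])
    have "(f has_real_derivative a * (c - c / (c - x t)\<^sup>2 - x t)) (at (x t))" for t
      unfolding f_def by (intro DERIV_cmult force_derivative x_lt)
    from DERIV_chain2[OF this x]
    show "((\<lambda>t. f (x t) - k * p t) has_real_derivative
      a * (c - c / (c - x t)\<^sup>2 - x t) * p t - k * (f (x t) - k * p t)) (at t)" for t
      by (intro DERIV_diff DERIV_cmult p')
    show "\<bar>a * (c - c / (c - x t)\<^sup>2 - x t) * p t - k * (f (x t) - k * p t)\<bar>
      \<le> a * (c + c / (c - b)\<^sup>2) * P + k * Q" for t
    proof -
      have "(c - b)\<^sup>2 \<le> (c - x t)\<^sup>2" using range[of t] \<open>b < c\<close> by (intro power_mono) auto
      then have "c / (c - x t)\<^sup>2 \<le> c / (c - b)\<^sup>2"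
        using \<open>b < c\<close> \<open>c > 1\<close> x_lt[of t] by (intro divide_left_mono) auto
      moreover have "0 \<le> c / (c - x t)\<^sup>2" using \<open>c > 1\<close> by simp
      ultimately have "\<bar>c - c / (c - x t)\<^sup>2 - x t\<bar> \<le> c + c / (c - b)\<^sup>2"
        by (intro abs_leI) (use x_lt[of t] x_pos[of t] in linarith)+
      then have "a * \<bar>c - c / (c - x t)\<^sup>2 - x t\<bar> * \<bar>p t\<bar> \<le> a * (c + c / (c - b)\<^sup>2) * P"
        using \<open>a > 0\<close> p_bd[of t] \<open>c > 1\<close> by (intro mult_mono mult_left_mono) auto
      moreover have "k * \<bar>f (x t) - k * p t\<bar> \<le> k * Q"
        using p'_bd[of t] \<open>k > 0\<close> by (intro mult_left_mono) auto
      moreover have "\<bar>a * (c - c / (c - x t)\<^sup>2 - x t) * p t\<bar> = a * \<bar>c - c / (c - x t)\<^sup>2 - x t\<bar> * \<bar>p t\<bar>"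
        and "\<bar>k * (f (x t) - k * p t)\<bar> = k * \<bar>f (x t) - k * p t\<bar>"
        using \<open>a > 0\<close> \<open>k > 0\<close> by (simp_all add: abs_mult)
      ultimately show ?thesis
        using abs_triangle_ineq4[of "a * (c - c / (c - x t)\<^sup>2 - x t) * p t" "k * (f (x t) - k * p t)"]
        by linarith
    qed
  qed
  from tendsto_add[OF this tendsto_mult[OF tendsto_const[of k] p_lim]]
  have f_lim: "((\<lambda>t. f (x t)) \<longlongrightarrow> 0) at_top" by simp
  \<comment> \<open>The solution of \<open>a * A * x = - E 0\<close>: later energies are at most
    \<open>E 0\<close>, so the linear bound on \<open>F\<close> keeps \<open>x\<close> above this
    value.\<close>
  define x0 where "x0 = - E 0 / (a * A)"
  have "E 0 < 0" using energy[of 0] by (simp add: E_def F_def)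
  then have "x0 > 0" using \<open>a > 0\<close> \<open>A > 0\<close> by (simp add: x0_def divide_pos_pos divide_neg_pos)
  have x_ge: "x0 \<le> x t" if "t \<ge> 0" for t
  proof -
    have "- E 0 \<le> F (x t)" using E_dec[OF that] zero_le_power2[of "p t"] unfolding E_def by linarith
    also have "\<dots> \<le> a * A * x t" using F_le[of t] by (simp add: mult.assoc)
    finally show ?thesis using \<open>a > 0\<close> \<open>A > 0\<close> by (simp add: x0_def field_simps)
  qed
  have "((\<lambda>t. x t - u0 c) \<longlongrightarrow> 0) at_top"
  proof (rule Lim_null_comparison)
    \<comment> \<open>The factorization is read backwards: its other factors are at least
      \<open>x0\<close> and \<open>c - u0 c\<close>, so the force controls the distance to
      \<open>u0 c\<close>.\<close>
    have "\<bar>x t - u0 c\<bar> \<le> 2 / (x0 * a) * c / (c - u0 c) * \<bar>f (x t)\<bar>" if "t \<ge> 0" for t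
    proof -
      have "c - u0 c > 0" using u0_bounds[OF \<open>c > 1\<close>] by simp
      have "(x0 * (c - u0 c)) * \<bar>x t - u0 c\<bar> \<le> (x t * (3 * c - u0 c - x t)) * \<bar>x t - u0 c\<bar>"
        using x_ge[OF that] x_lt[of t] \<open>x0 > 0\<close> \<open>c - u0 c > 0\<close> \<open>c > 1\<close>
        by (intro mult_right_mono mult_mono) auto
      also have "\<dots> = \<bar>x t * (u0 c - x t) * (3 * c - u0 c - x t)\<bar>"
        using x_pos[of t] x_lt[of t] \<open>c - u0 c > 0\<close> by (simp add: abs_mult abs_minus_commute)
      also have "\<dots> = 2 * (c - x t) * \<bar>force c (x t)\<bar>"
        using x_lt[of t] by (simp flip: force_factorization add: abs_mult)
      also have "\<dots> \<le> 2 * c * \<bar>force c (x t)\<bar>"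
        using x_pos[of t] by (intro mult_right_mono) auto
      also have "\<dots> = 2 / a * c * \<bar>f (x t)\<bar>" using \<open>a > 0\<close> by (simp add: f_def abs_mult)
      finally show ?thesis using \<open>x0 > 0\<close> \<open>c - u0 c > 0\<close> \<open>a > 0\<close>
        by (simp add: field_simps)
    qed
    then show "\<forall>\<^sub>F t in at_top. norm (x t - u0 c) \<le> 2 / (x0 * a) * c / (c - u0 c) * \<bar>f (x t)\<bar>"
      by (auto intro: eventually_at_top_linorderI[of 0])
    show "((\<lambda>t. 2 / (x0 * a) * c / (c - u0 c) * \<bar>f (x t)\<bar>) \<longlongrightarrow> 0) at_top"
      using tendsto_mult[OF tendsto_const[of "2 / (x0 * a) * c / (c - u0 c)"] tendsto_rabs[OF f_lim]]
      by simp
  qed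
  then show "(x \<longlongrightarrow> u0 c) at_top" by (rule LIM_zero_cancel)
qed

section \<open>Existence of the connecting orbit\<close>

lemma connecting_solution_exists:
  fixes \<delta> \<epsilon> c :: real
  assumes "\<delta> > 0" "\<epsilon> > 0" "c > 1"
  shows "\<exists>u v. connecting_solution \<delta> \<epsilon> c u v"
proof -
  define a where "a = inverse (\<delta> * c)"
  define k where "k = \<epsilon> * a"
  have "a > 0" "k > 0" using assms by (simp_all add: a_def k_def)
  obtain b where b: "0 < b" "b < c" "potential c b < 0"
    using potential_negative_near_c[of c] \<open>c > 1\<close> by auto
  \<comment> \<open>\<open>c - 1 / c\<close> is the slope of \<open>force c\<close> at 0;
    \<open>c > 1\<close> makes it positive, so that 0 is a saddle.\<close>
  define \<mu> where "\<mu> = a * (c - 1 / c)"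
  have "1 < c * c" using \<open>c > 1\<close> less_1_mult by blast
  then have "\<mu> > 0" using \<open>a > 0\<close> \<open>c > 1\<close> by (simp add: \<mu>_def field_simps)
  define m where "m y = a * (1 / 2 + 1 / (c * (c - y)))" for y
  \<comment> \<open>The slope of \<open>m\<close> at \<open>y\<close> is
    \<open>a / (c * (c - y)\<^sup>2)\<close>, which on \<open>{0..b}\<close> is largest at
    \<open>b\<close>.\<close>
  define C where "C = a / (c * (c - b)\<^sup>2)"
  have m_nonneg: "0 \<le> m y" if "y \<in> {0..b}" for y
    using that b \<open>a > 0\<close> \<open>c > 1\<close> by (simp add: m_def)
  have m_lip: "\<bar>m y - m z\<bar> \<le> C * \<bar>y - z\<bar>" if "y \<in> {0..b}" "z \<in> {0..b}" for y z
  proof -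
    have "1 / (c * (c - y)) - 1 / (c * (c - z)) = (y - z) / (c * ((c - y) * (c - z)))"
      using that b \<open>c > 1\<close> by (simp add: divide_simps)
    moreover have "m y - m z = a * (1 / (c * (c - y)) - 1 / (c * (c - z)))"
      by (simp add: m_def algebra_simps)
    ultimately have "m y - m z = a / (c * ((c - y) * (c - z))) * (y - z)" by simp
    also have "\<bar>\<dots>\<bar> = a / (c * ((c - y) * (c - z))) * \<bar>y - z\<bar>"
      using that b \<open>a > 0\<close> \<open>c > 1\<close> by (simp add: abs_mult)
    also have "\<dots> \<le> C * \<bar>y - z\<bar>"
    proof (rule mult_right_mono)
      have "(c - b) * (c - b) \<le> (c - y) * (c - z)" using that b by (intro mult_mono) auto
      then show "a / (c * ((c - y) * (c - z))) \<le> C"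
        unfolding C_def power2_eq_square using that b \<open>a > 0\<close> \<open>c > 1\<close>
        by (intro divide_left_mono mult_left_mono mult_pos_pos) auto
    qed simp
    finally show ?thesis .
  qed
  obtain x p where x: "\<And>t. (x has_real_derivative p t) (at t)"
    and p: "\<And>t. (p has_real_derivative
        \<mu> * x t - k * p t - (max 0 (x t))\<^sup>2 * m (min (max 0 (x t)) b)) (at t)"
    and x_lim: "(x \<longlongrightarrow> 0) at_bot" and p_lim: "(p \<longlongrightarrow> 0) at_bot"
    and x_ev: "\<forall>\<^sub>F t in at_bot. 0 < x t"
    using unstable_manifold_exists[of \<mu> k b m C] \<open>\<mu> > 0\<close> \<open>k > 0\<close> \<open>0 < b\<close> m_nonneg m_lip
    by (metis less_imp_le)
  \<comment> \<open>The truncated force, continuous on the whole line and equal to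
    \<open>a * force c\<close> on \<open>{0..b}\<close>. Until confinement is known, the energy must
    use its own antiderivative \<open>F\<close>, since \<open>potential c\<close> is an
    antiderivative only below \<open>c\<close>.\<close>
  define f where "f y = \<mu> * y - (max 0 y)\<^sup>2 * m (min (max 0 y) b)" for y
  have p': "(p has_real_derivative f (x t) - k * p t) (at t)" for t
    using p[of t] by (simp add: f_def algebra_simps)
  have f_eq: "f y = a * force c y" if "y \<in> {0..b}" for y
    using that b \<open>c > 1\<close>
    by (simp add: force_near_0 f_def \<mu>_def m_def max_absorb2 min_absorb1 algebra_simps)
  have "c * (c - min (max 0 y) b) \<noteq> 0" for y using b \<open>c > 1\<close> by auto
  then have "continuous_on UNIV f"
    unfolding f_def m_def by (intro continuous_intros) auto
  from antiderivative_exists[OF this] obtain F where F: "\<And>y. (F has_real_derivative f y) (at y)" and "F 0 = 0"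
    by metis
  have F_eq: "F y = a * potential c y" if "y \<in> {0..b}" for y
  proof -
    have der: "((\<lambda>y. F y - a * potential c y) has_real_derivative f y - a * force c y) (at y)"
      if "y < c" for y
      using that by (intro DERIV_diff DERIV_cmult F potential_derivative)
    have "F y - a * potential c y = F 0 - a * potential c 0"
    proof (rule DERIV_isconst2[OF \<open>0 < b\<close>])
      show "continuous_on {0..b} (\<lambda>y. F y - a * potential c y)"
        using \<open>b < c\<close> by (intro continuous_at_imp_continuous_on ballI DERIV_isCont[OF der]) auto
      show "((\<lambda>y. F y - a * potential c y) has_real_derivative 0) (at y)" if "0 < y" "y < b" for y
        using der[of y] that \<open>b < c\<close> by (simp add: f_eq)
    qed (use that in auto)
    then show ?thesis by (simp add: \<open>F 0 = 0\<close> potential_0)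
  qed
  have energy: "(p t)\<^sup>2 / 2 < F (x t)" for t
    by (rule damped_energy_negative[of x p f k F, OF x p' F \<open>F 0 = 0\<close> \<open>k > 0\<close> x_lim p_lim x_ev])
  \<comment> \<open>\<open>F\<close> is positive along the orbit but not at 0 or \<open>b\<close>;
    hence the truncation is never active and \<open>x\<close> solves the original equation.\<close>
  have range: "0 < x t \<and> x t < b" for t
  proof (rule confined_by_potential[of x F, OF _ _ _ _ \<open>0 < b\<close> x_lim x_ev])
    show "continuous_on UNIV x"
      using x by (intro continuous_at_imp_continuous_on ballI DERIV_isCont)
    show "0 < F (x t)" for t using energy[of t] zero_le_power2[of "p t"] by linarith
    show "F b \<le> 0" using b \<open>a > 0\<close> by (simp add: F_eq mult_nonneg_nonpos)
  qed (simp add: \<open>F 0 = 0\<close>)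
  have x_mem: "x t \<in> {0..b}" for t using range[of t] by simp
  have p'': "(p has_real_derivative a * force c (x t) - k * p t) (at t)" for t
    using p'[of t] by (simp only: f_eq[OF x_mem])
  have energy': "(p t)\<^sup>2 / 2 < a * potential c (x t)" for t
    using energy[of t] by (simp only: F_eq[OF x_mem])
  note limits = oscillator_tendsto_u0[of a k c b x p,
      OF \<open>a > 0\<close> \<open>k > 0\<close> \<open>c > 1\<close> \<open>b < c\<close> x p'' range energy']
  obtain P where P: "\<And>t. \<bar>p t\<bar> \<le> P" using limits(3) by blast
  \<comment> \<open>Return to \<open>\<xi> = - t\<close>; the equation \<open>u' = a * v\<close>
    dictates the factor \<open>- 1 / a\<close> in \<open>v\<close>.\<close>
  define u where "u \<xi> = x (- \<xi>)" for \<xi>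
  define v where "v \<xi> = - (p (- \<xi>) / a)" for \<xi>
  have "(u has_real_derivative a * v \<xi>) (at \<xi>)" for \<xi>
  proof -
    have "(u has_real_derivative - p (- \<xi>)) (at \<xi>)"
      unfolding u_def using x[of "- \<xi>"] by (simp add: DERIV_mirror)
    then show ?thesis using \<open>a > 0\<close> by (simp add: v_def)
  qed
  moreover have "(v has_real_derivative force c (u \<xi>) + \<epsilon> * a * v \<xi>) (at \<xi>)" for \<xi>
  proof -
    have "((\<lambda>\<xi>. p (- \<xi>)) has_real_derivative - (a * force c (u \<xi>) - k * p (- \<xi>))) (at \<xi>)"
      using p''[of "- \<xi>"] by (simp add: DERIV_mirror u_def)
    then have "(v has_real_derivative - (- (a * force c (u \<xi>) - k * p (- \<xi>)) / a)) (at \<xi>)"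
      unfolding v_def by (intro DERIV_minus DERIV_cdivide)
    moreover have "- (- (a * force c (u \<xi>) - k * p (- \<xi>)) / a) = force c (u \<xi>) + \<epsilon> * a * v \<xi>"
      using \<open>a > 0\<close> by (simp add: v_def k_def field_simps)
    ultimately show ?thesis by simp
  qed
  ultimately have "global_solution \<delta> \<epsilon> c u v"
    by (simp add: global_solution_def vector_field_def a_def force_def)
  moreover have "orbit u v \<subseteq> region_M c"
    using range b by (auto simp: orbit_def region_M_def u_def intro: less_trans)
  moreover have "bounded (orbit u v)"
  proof (rule bounded_subset)
    have "\<bar>v \<xi>\<bar> \<le> P / a" for \<xi>
      using P \<open>a > 0\<close> by (simp add: v_def divide_right_mono)
    then have "v \<xi> \<in> {- (P / a)..P / a}" for \<xi> by (simp add: abs_le_iff) (metis minus_le_iff)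
    then show "orbit u v \<subseteq> {0..b} \<times> {- (P / a)..P / a}"
      using x_mem by (auto simp: orbit_def u_def)
    show "bounded ({0..b} \<times> {- (P / a)..P / a})" by (intro bounded_Times) auto
  qed
  moreover have "((\<lambda>\<xi>. (u \<xi>, v \<xi>)) \<longlongrightarrow> (u0 c, 0)) at_bot"
  proof (rule tendsto_Pair)
    show "(u \<longlongrightarrow> u0 c) at_bot"
      unfolding u_def using limits(1) by (simp add: filterlim_at_bot_mirror)
    have "((\<lambda>t. - (p t / a)) \<longlongrightarrow> - (0 / a)) at_top"
      using \<open>a > 0\<close> by (intro tendsto_intros limits(2)) auto
    then show "(v \<longlongrightarrow> 0) at_bot"
      unfolding v_def by (simp add: filterlim_at_bot_mirror)
  qed
  moreover have "((\<lambda>\<xi>. (u \<xi>, v \<xi>)) \<longlongrightarrow> (0, 0)) at_top"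
  proof (rule tendsto_Pair)
    show "(u \<longlongrightarrow> 0) at_top"
      unfolding u_def using x_lim by (simp add: filterlim_at_bot_mirror)
    have "((\<lambda>t. - (p t / a)) \<longlongrightarrow> - (0 / a)) at_bot"
      using \<open>a > 0\<close> by (intro tendsto_intros p_lim) auto
    then show "(v \<longlongrightarrow> 0) at_top"
      unfolding v_def by (simp add: filterlim_at_bot_mirror)
  qed
  ultimately show ?thesis by (auto simp: connecting_solution_def)
qed

section \<open>Uniqueness\<close>

text \<open>The explicit difference quotient is continuous along two solutions that stay below
  \<open>c\<close>, hence bounded on compact time intervals.\<close>

lemma force_diff:
  assumes "u < c" "w < c"
  shows "force c u - force c w = (u - w) * (c - c / ((c - u) * (c - w)) - (u + w) / 2)"
proof -
  define q where "q = c / ((c - u) * (c - w))"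
  have *: "u / (u - c) - w / (w - c) = - ((u - w) * q)"
    using assms unfolding q_def by (simp add: divide_simps) (simp add: algebra_simps)
  have "force c u - force c w = c * (u - w) + (u / (u - c) - w / (w - c)) - (u\<^sup>2 - w\<^sup>2) / 2"
    by (simp add: force_def algebra_simps diff_divide_distrib)
  then show ?thesis
    unfolding * q_def[symmetric] by (simp add: power2_eq_square algebra_simps diff_divide_distrib)
qed

lemma gronwall_nonpos:
  fixes D D' :: "real \<Rightarrow> real"
  assumes "0 \<le> t" "D 0 = 0"
    and der: "\<And>s. s \<in> {0..t} \<Longrightarrow> (D has_real_derivative D' s) (at s)"
    and le: "\<And>s. s \<in> {0..t} \<Longrightarrow> D' s \<le> K * D s"
  shows "D t \<le> 0"
proof -
  have "exp (- K * t) * D t \<le> exp (- K * 0) * D 0"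
  proof (rule DERIV_nonpos_imp_nonincreasing[OF \<open>0 \<le> t\<close>])
    fix s assume "0 \<le> s" "s \<le> t"
    then have "((\<lambda>s. exp (- K * s) * D s) has_real_derivative exp (- K * s) * (D' s - K * D s)) (at s)"
      by (auto intro!: derivative_eq_intros der simp: algebra_simps)
    moreover have "exp (- K * s) * (D' s - K * D s) \<le> 0"
      using le[of s] \<open>0 \<le> s\<close> \<open>s \<le> t\<close> by (intro mult_nonneg_nonpos) auto
    ultimately show "\<exists>y. ((\<lambda>s. exp (- K * s) * D s) has_real_derivative y) (at s) \<and> y \<le> 0" by blast
  qed
  then show ?thesis using \<open>D 0 = 0\<close> by (simp add: mult_le_0_iff)
qed

text \<open>The given system for \<open>a = inverse (\<delta> * c)\<close> and
  \<open>e = \<epsilon> * a\<close>, with the nonlinearity collected in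
  \<open>force\<close>.\<close>

definition travelling_wave ::
  "real \<Rightarrow> real \<Rightarrow> real \<Rightarrow> (real \<Rightarrow> real) \<Rightarrow> (real \<Rightarrow> real) \<Rightarrow> bool" where
  "travelling_wave a e c u v \<longleftrightarrow>
    (\<forall>\<xi>. (u has_real_derivative a * v \<xi>) (at \<xi>) \<and>
          (v has_real_derivative force c (u \<xi>) + e * v \<xi>) (at \<xi>))"

text \<open>The field is singular at \<open>u = c\<close>, but on a compact time interval both
  solutions keep away from \<open>c\<close>. This gives a Lipschitz factor \<open>g\<close> there,
  and Gronwall's inequality applies to the squared distance.\<close>

lemma travelling_wave_unique:
  assumes uv: "travelling_wave a e c u v" and wz: "travelling_wave a e c w z"
    and lt: "\<And>\<xi>. u \<xi> < c" "\<And>\<xi>. w \<xi> < c"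
    and init: "u 0 = w 0" "v 0 = z 0"
  shows "u \<xi> = w \<xi> \<and> v \<xi> = z \<xi>"
proof -
  have du: "(u has_real_derivative a * v s) (at s)" and dv: "(v has_real_derivative force c (u s) + e * v s) (at s)"
    and dw: "(w has_real_derivative a * z s) (at s)" and dz: "(z has_real_derivative force c (w s) + e * z s) (at s)"
    for s using uv wz by (auto simp: travelling_wave_def)
  define T where "T = \<bar>\<xi>\<bar>"
  define g where "g s = c - c / ((c - u s) * (c - w s)) - (u s + w s) / 2" for s
  have cont: "continuous_on {-T..T} u" "continuous_on {-T..T} w"
    using du dw by (auto intro!: continuous_at_imp_continuous_on DERIV_isCont)
  have "(c - u s) * (c - w s) \<noteq> 0" for s using lt[of s] by simp
  then have "continuous_on {-T..T} g"
    unfolding g_def by (intro continuous_intros cont) auto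
  then have "bounded (g ` {-T..T})" by (intro compact_imp_bounded compact_continuous_image) auto
  then obtain M where M: "\<forall>s\<in>{-T..T}. \<bar>g s\<bar> \<le> M"
    by (auto simp: bounded_iff)
  define D where "D s = (u s - w s)\<^sup>2 + (v s - z s)\<^sup>2" for s
  define D' where "D' s = 2 * ((a + g s) * (u s - w s) * (v s - z s) + e * (v s - z s)\<^sup>2)" for s
  have D: "(D has_real_derivative D' s) (at s)" for s
  proof -
    have "(D has_real_derivative 2 * ((u s - w s) * (a * v s - a * z s)) +
        2 * ((v s - z s) * ((force c (u s) + e * v s) - (force c (w s) + e * z s)))) (at s)"
      unfolding D_def by (auto intro!: derivative_eq_intros du dv dw dz)
    also have "(force c (u s) + e * v s) - (force c (w s) + e * z s) = (u s - w s) * g s + e * (v s - z s)"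
      using force_diff[OF lt(1)[of s] lt(2)[of s]] by (simp add: g_def algebra_simps)
    also have "2 * ((u s - w s) * (a * v s - a * z s)) +
        2 * ((v s - z s) * ((u s - w s) * g s + e * (v s - z s))) = D' s"
      by (simp add: D'_def power2_eq_square algebra_simps)
    finally show ?thesis .
  qed
  define K where "K = \<bar>a\<bar> + M + 2 * \<bar>e\<bar>"
  \<comment> \<open>Bounding the absolute value serves both directions of time: negative times are
    handled through \<open>D (- s)\<close>.\<close>
  have D'_le: "\<bar>D' s\<bar> \<le> K * D s" if "s \<in> {-T..T}" for s
  proof -
    define p q where "p = \<bar>u s - w s\<bar>" and "q = \<bar>v s - z s\<bar>"
    have pq: "0 \<le> p" "0 \<le> q" "D s = p\<^sup>2 + q\<^sup>2" by (simp_all add: p_def q_def D_def)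
    have "\<bar>a + g s\<bar> \<le> \<bar>a\<bar> + M" using bspec[OF M that] by linarith
    have "0 \<le> (p - q)\<^sup>2" by simp
    then have "2 * (p * q) \<le> D s" by (simp add: pq power2_eq_square algebra_simps)
    have "\<bar>D' s\<bar> \<le> 2 * (\<bar>(a + g s) * (u s - w s) * (v s - z s)\<bar> + \<bar>e * (v s - z s)\<^sup>2\<bar>)"
      unfolding D'_def abs_mult[of 2] by (intro mult_mono abs_triangle_ineq) auto
    also have "\<dots> = \<bar>a + g s\<bar> * (2 * (p * q)) + 2 * \<bar>e\<bar> * q\<^sup>2"
      by (simp add: abs_mult p_def q_def)
    also have "\<dots> \<le> (\<bar>a\<bar> + M) * D s + 2 * \<bar>e\<bar> * D s"
      using \<open>\<bar>a + g s\<bar> \<le> \<bar>a\<bar> + M\<close> \<open>2 * (p * q) \<le> D s\<close> pq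
      by (intro add_mono mult_mono mult_left_mono) auto
    finally show ?thesis by (simp add: K_def algebra_simps)
  qed
  have D0: "D 0 = 0" using init by (simp add: D_def)
  have "D \<xi> \<le> 0"
  proof (cases "0 \<le> \<xi>")
    case True
    show ?thesis
    proof (rule gronwall_nonpos[OF True D0 D])
      show "D' s \<le> K * D s" if "s \<in> {0..\<xi>}" for s
        using that D'_le[of s] True by (auto simp: T_def)
    qed
  next
    case False
    have "D (- (- \<xi>)) \<le> 0"
    proof (rule gronwall_nonpos[of "- \<xi>" "\<lambda>s. D (- s)"])
      show "((\<lambda>s. D (- s)) has_real_derivative - D' (- s)) (at s)" for s
        using D[of "- s"] by (simp add: DERIV_mirror)
      show "- D' (- s) \<le> K * D (- s)" if "s \<in> {0..- \<xi>}" for s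
        using that D'_le[of "- s"] False by (auto simp: T_def)
    qed (use False D0 in auto)
    then show ?thesis by simp
  qed
  then show ?thesis by (simp add: D_def sum_power2_le_zero_iff)
qed

lemma travelling_wave_shift:
  assumes "travelling_wave a e c u v"
  shows "travelling_wave a e c (\<lambda>\<xi>. u (\<xi> + s)) (\<lambda>\<xi>. v (\<xi> + s))"
  using assms unfolding travelling_wave_def by (auto intro: DERIV_shift[THEN iffD1])

section \<open>The end of an orbit at the saddle as a graph over \<open>u\<close>\<close>

text \<open>Once \<open>u < u0 c\<close> for good, the force is positive. If then
  \<open>v \<ge> 0\<close> at some time, \<open>v\<close> is positive ever after, and since
  \<open>e \<ge> 0\<close> it also grows, so it cannot tend to 0.\<close>

lemma travelling_wave_eventually_decreasing:
  assumes sol: "travelling_wave a e c u v" and "c > 1" "e \<ge> 0"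
    and pos: "\<And>\<xi>. 0 < u \<xi>" and u_lim: "(u \<longlongrightarrow> 0) at_top" and v_lim: "(v \<longlongrightarrow> 0) at_top"
  shows "\<forall>\<^sub>F \<xi> in at_top. v \<xi> < 0 \<and> u \<xi> < u0 c"
proof -
  have dv: "(v has_real_derivative force c (u \<xi>) + e * v \<xi>) (at \<xi>)" for \<xi>
    using sol by (simp add: travelling_wave_def)
  have ev: "\<forall>\<^sub>F \<xi> in at_top. u \<xi> < u0 c"
    using u_lim u0_bounds(1)[OF \<open>c > 1\<close>] by (rule order_tendstoD)
  then obtain N where N: "\<And>\<xi>. \<xi> \<ge> N \<Longrightarrow> u \<xi> < u0 c"
    by (auto simp: eventually_at_top_linorder)
  have f_pos: "0 < force c (u \<xi>)" if "\<xi> \<ge> N" for \<xi>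
    using force_pos[OF \<open>c > 1\<close> pos N[OF that]] .
  have "v r < 0" if "r \<ge> N" for r
  proof (rule ccontr)
    assume "\<not> v r < 0"
    then have "v r \<ge> 0" by simp
    have v_pos: "0 < v s" if "r < s" for s
    proof -
      have "exp (- e * r) * v r < exp (- e * s) * v s"
      proof (rule DERIV_pos_imp_increasing[OF that])
        fix t assume "r \<le> t" "t \<le> s"
        have "((\<lambda>t. exp (- e * t) * v t) has_real_derivative exp (- e * t) * force c (u t)) (at t)"
          by (auto intro!: derivative_eq_intros dv simp: algebra_simps)
        moreover have "exp (- e * t) * force c (u t) > 0"
          using f_pos[of t] \<open>r \<ge> N\<close> \<open>r \<le> t\<close> by simp
        ultimately show "\<exists>y. ((\<lambda>t. exp (- e * t) * v t) has_real_derivative y) (at t) \<and> y > 0"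
          by blast
      qed
      moreover have "0 \<le> exp (- e * r) * v r" using \<open>v r \<ge> 0\<close> by simp
      ultimately have "0 < exp (- e * s) * v s" by linarith
      then show ?thesis by (simp add: zero_less_mult_iff)
    qed
    \<comment> \<open>\<open>v r\<close> itself may be 0; one unit later \<open>v\<close> is
      strictly positive, and this value bounds the limit from below.\<close>
    have "v (r + 1) \<le> v s" if "r + 1 \<le> s" for s
    proof (rule DERIV_nonneg_imp_nondecreasing[OF that])
      fix t assume "r + 1 \<le> t" "t \<le> s"
      then have "0 \<le> force c (u t) + e * v t"
        using f_pos[of t] v_pos[of t] \<open>r \<ge> N\<close> \<open>e \<ge> 0\<close> by simp
      then show "\<exists>y. (v has_real_derivative y) (at t) \<and> y \<ge> 0" using dv[of t] by blast
    qed
    then have "v (r + 1) \<le> 0"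
      by (intro tendsto_lowerbound[OF v_lim]) (auto intro: eventually_at_top_linorderI[of "r + 1"])
    with v_pos[of "r + 1"] show False by simp
  qed
  then have "\<forall>\<^sub>F \<xi> in at_top. v \<xi> < 0" by (auto intro: eventually_at_top_linorderI[of N])
  with ev show ?thesis by eventually_elim simp
qed

text \<open>Taking \<open>u\<close> as the independent variable removes the freedom of translation.
  After \<open>N\<close> the function \<open>u\<close> is strictly decreasing, and
  \<open>W' = v' / u'\<close> becomes a scalar equation.\<close>

lemma travelling_wave_graph:
  assumes sol: "travelling_wave a e c u v" and "a > 0"
    and pos: "\<And>\<xi>. 0 < u \<xi>" and u_lim: "(u \<longlongrightarrow> 0) at_top" and v_lim: "(v \<longlongrightarrow> 0) at_top"
    and neg: "\<And>\<xi>. \<xi> \<ge> N \<Longrightarrow> v \<xi> < 0"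
  obtains W where "\<And>x. x \<in> {0<..<u N} \<Longrightarrow> \<exists>\<xi>. u \<xi> = x \<and> v \<xi> = W x"
    and "\<And>x. x \<in> {0<..<u N} \<Longrightarrow> W x < 0"
    and "\<And>x. x \<in> {0<..<u N} \<Longrightarrow> (W has_real_derivative force c x / (a * W x) + e / a) (at x)"
    and "(W \<longlongrightarrow> 0) (at_right 0)"
proof -
  have du: "(u has_real_derivative a * v \<xi>) (at \<xi>)"
    and dv: "(v has_real_derivative force c (u \<xi>) + e * v \<xi>) (at \<xi>)" for \<xi>
    using sol by (simp_all add: travelling_wave_def)
  have dec: "u t < u s" if "N \<le> s" "s < t" for s t
    using that du neg \<open>a > 0\<close>
    by (intro DERIV_neg_imp_decreasing[OF \<open>s < t\<close>]) (meson mult_pos_neg order_trans)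
  have inj: "inj_on u {N..}"
    by (rule linorder_inj_onI') (use dec in force)
  define g where "g = inv_into {N..} u"
  have g_u: "g (u s) = s" if "s \<ge> N" for s
    unfolding g_def using inj that by (simp add: inv_into_f_f)
  \<comment> \<open>Strictness \<open>s > N\<close> provides a two-sided neighbourhood of
    \<open>g x\<close> in \<open>{N..}\<close> for the inverse function rule.\<close>
  have ex: "\<exists>s>N. u s = x" if "x \<in> {0<..<u N}" for x
  proof -
    have "\<forall>\<^sub>F t in at_top. u t < x \<and> t > N"
      using order_tendstoD(2)[OF u_lim, of x] that by (auto intro: eventually_conj eventually_gt_at_top)
    then obtain t where "u t < x" "t > N" using eventually_happens'[OF trivial_limit_at_top_linorder] by blast
    then have "\<exists>s. N \<le> s \<and> s \<le> t \<and> u s = x"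
      using that du by (intro IVT2) (auto intro: DERIV_isCont)
    then show ?thesis using that by (metis greaterThanLessThan_iff less_le order_le_less)
  qed
  define W where "W x = v (g x)" for x
  have g: "g x > N" "u (g x) = x" if "x \<in> {0<..<u N}" for x
    using ex[OF that] g_u by auto
  show thesis
  proof
    show "\<exists>\<xi>. u \<xi> = x \<and> v \<xi> = W x" if "x \<in> {0<..<u N}" for x
      using g[OF that] by (auto simp: W_def)
    show W_neg: "W x < 0" if "x \<in> {0<..<u N}" for x
      using g[OF that] neg by (simp add: W_def)
    show "(W has_real_derivative force c x / (a * W x) + e / a) (at x)" if x: "x \<in> {0<..<u N}" for x
    proof -
      have "isCont g (u (g x))"
      proof (rule isCont_inverse_function[where f = u and d = "g x - N"])
        show "0 < g x - N" using g[OF x] by simp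
        show "g (u z) = z" if "\<bar>z - g x\<bar> \<le> g x - N" for z using that by (intro g_u) (simp add: abs_if split: if_splits)
        show "isCont u z" for z using du by (rule DERIV_isCont)
      qed
      then have "isCont g x" using g[OF x] by simp
      have "(g has_real_derivative inverse (a * v (g x))) (at x)"
      proof (rule DERIV_inverse_function[OF du])
        show "a * v (g x) \<noteq> 0" using W_neg[OF x] \<open>a > 0\<close> by (simp add: W_def)
        show "0 < x" "x < u N" using x by auto
        show "u (g y) = y" if "0 < y" "y < u N" for y using g that by simp
      qed fact
      from DERIV_chain2[OF dv this]
      have "(W has_real_derivative (force c x + e * W x) * inverse (a * W x)) (at x)"
        unfolding W_def by (simp only: g(2)[OF x])
      moreover have "(force c x + e * W x) * inverse (a * W x) = force c x / (a * W x) + e / a"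
        using W_neg[OF x] \<open>a > 0\<close> by (simp add: divide_simps)
      ultimately show ?thesis by simp
    qed
    show "(W \<longlongrightarrow> 0) (at_right 0)"
    proof (rule tendstoI)
      fix r :: real assume "r > 0"
      then have "\<forall>\<^sub>F t in at_top. dist (v t) 0 < r \<and> t \<ge> N"
        using v_lim by (intro eventually_conj tendstoD eventually_ge_at_top)
      then obtain M where M: "\<And>t. t \<ge> M \<Longrightarrow> dist (v t) 0 < r" "M \<ge> N"
        unfolding eventually_at_top_linorder by blast
      have "dist (W x) 0 < r" if "0 < x" "x < u M" for x
      proof -
        have "u M \<le> u N" using dec[of N M] \<open>M \<ge> N\<close> by (cases "M = N") auto
        with that have x: "x \<in> {0<..<u N}" by auto
        have "M \<le> g x" using dec[of "g x" M] g[OF x] that by (cases "g x < M") auto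
        then show ?thesis using M by (simp add: W_def)
      qed
      then show "\<forall>\<^sub>F x in at_right 0. dist (W x) 0 < r"
        using pos[of M] by (auto simp: eventually_at_right_field)
    qed
  qed
qed

text \<open>Two such graphs repel each other as \<open>x\<close> decreases to \<open>0\<close>, so they cannot both end
  at the saddle point unless they coincide.\<close>

lemma graph_unique:
  fixes f W V :: "real \<Rightarrow> real"
  assumes "a > 0"
    and f: "\<And>x. x \<in> {0<..<x0} \<Longrightarrow> 0 \<le> f x"
    and W: "\<And>x. x \<in> {0<..<x0} \<Longrightarrow> W x < 0" and V: "\<And>x. x \<in> {0<..<x0} \<Longrightarrow> V x < 0"
    and dW: "\<And>x. x \<in> {0<..<x0} \<Longrightarrow> (W has_real_derivative f x / (a * W x) + b) (at x)"
    and dV: "\<And>x. x \<in> {0<..<x0} \<Longrightarrow> (V has_real_derivative f x / (a * V x) + b) (at x)"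
    and lim: "(W \<longlongrightarrow> 0) (at_right 0)" "(V \<longlongrightarrow> 0) (at_right 0)"
    and x: "x \<in> {0<..<x0}"
  shows "W x = V x"
proof -
  define d where "d x = (W x - V x)\<^sup>2" for x
  have dec: "d x \<le> d y" if "0 < y" "y < x" for y
  proof (rule DERIV_nonpos_imp_nonincreasing[where f = d and a = y and b = x])
    fix t assume "y \<le> t" "t \<le> x"
    with that x have t: "t \<in> {0<..<x0}" by auto
    have "(d has_real_derivative 2 * ((W t - V t) * ((f t / (a * W t) + b) - (f t / (a * V t) + b)))) (at t)"
      unfolding d_def by (auto intro!: derivative_eq_intros dW dV t)
    \<comment> \<open>The constant \<open>b\<close> cancels and
      \<open>1 / W t - 1 / V t = - (W t - V t) / (W t * V t)\<close>; equal signs of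
      \<open>W\<close> and \<open>V\<close> make the derivative nonpositive.\<close>
    moreover have "2 * ((W t - V t) * ((f t / (a * W t) + b) - (f t / (a * V t) + b))) =
        - (2 * f t * (W t - V t)\<^sup>2 / (a * (W t * V t)))"
      using W[OF t] V[OF t] \<open>a > 0\<close> by (simp add: divide_simps) (simp add: power2_eq_square algebra_simps)
    moreover have "0 < W t * V t" using W[OF t] V[OF t] by (rule mult_neg_neg)
    then have "0 \<le> 2 * f t * (W t - V t)\<^sup>2 / (a * (W t * V t))"
      using f[OF t] \<open>a > 0\<close> by simp
    ultimately show "\<exists>y. (d has_real_derivative y) (at t) \<and> y \<le> 0" by fastforce
  qed (use that in simp)
  have "(d \<longlongrightarrow> (0 - 0)\<^sup>2) (at_right 0)"
    unfolding d_def by (intro tendsto_intros lim)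
  moreover have "\<forall>\<^sub>F y in at_right 0. d x \<le> d y"
    using dec x by (auto simp: eventually_at_right_field)
  ultimately have "d x \<le> (0 - 0)\<^sup>2" by (intro tendsto_lowerbound) auto
  then show ?thesis by (simp add: d_def)
qed

lemma connecting_solution_unique:
  fixes \<delta> \<epsilon> c :: real
  assumes "\<delta> > 0" "\<epsilon> > 0" "c > 1"
    and uv: "connecting_solution \<delta> \<epsilon> c u v" and wz: "connecting_solution \<delta> \<epsilon> c w z"
  shows "\<exists>s. \<forall>\<xi>. w \<xi> = u (\<xi> + s) \<and> z \<xi> = v (\<xi> + s)"
proof -
  define a where "a = inverse (\<delta> * c)"
  have "a > 0" "\<epsilon> * a \<ge> 0" using assms by (simp_all add: a_def)
  have *: "travelling_wave a (\<epsilon> * a) c u v" "0 < u \<xi>" "u \<xi> < c" "(u \<longlongrightarrow> 0) at_top" "(v \<longlongrightarrow> 0) at_top"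
    if "connecting_solution \<delta> \<epsilon> c u v" for u v \<xi>
  proof -
    have "((\<lambda>\<xi>. (u \<xi>, v \<xi>)) \<longlongrightarrow> (0, 0)) at_top" using that by (simp add: connecting_solution_def)
    from tendsto_fst[OF this] tendsto_snd[OF this]
    show "(u \<longlongrightarrow> 0) at_top" "(v \<longlongrightarrow> 0) at_top" by simp_all
    have "(u \<xi>, v \<xi>) \<in> region_M c"
      using that by (auto simp: connecting_solution_def orbit_def)
    then show "0 < u \<xi>" "u \<xi> < c" by (auto simp: region_M_def)
    show "travelling_wave a (\<epsilon> * a) c u v"
      using that by (auto simp: connecting_solution_def global_solution_def vector_field_def
          travelling_wave_def force_def a_def)
  qed
  note ev = travelling_wave_eventually_decreasing[OF *(1) \<open>c > 1\<close> \<open>\<epsilon> * a \<ge> 0\<close> *(2,4,5)]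
  have "\<forall>\<^sub>F \<xi> in at_top. (v \<xi> < 0 \<and> u \<xi> < u0 c) \<and> (z \<xi> < 0 \<and> w \<xi> < u0 c)"
    by (rule eventually_conj[OF ev[OF uv uv uv uv] ev[OF wz wz wz wz]])
  then obtain N where N: "\<And>\<xi>. \<xi> \<ge> N \<Longrightarrow> v \<xi> < 0" "\<And>\<xi>. \<xi> \<ge> N \<Longrightarrow> z \<xi> < 0" "u N < u0 c"
    by (auto simp: eventually_at_top_linorder)
  obtain W where W: "\<And>x. x \<in> {0<..<u N} \<Longrightarrow> \<exists>\<xi>. u \<xi> = x \<and> v \<xi> = W x"
    "\<And>x. x \<in> {0<..<u N} \<Longrightarrow> W x < 0"
    "\<And>x. x \<in> {0<..<u N} \<Longrightarrow> (W has_real_derivative force c x / (a * W x) + (\<epsilon> * a) / a) (at x)"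
    "(W \<longlongrightarrow> 0) (at_right 0)"
    using travelling_wave_graph[OF *(1)[OF uv] \<open>a > 0\<close> *(2,4,5)[OF uv] N(1)] by blast
  obtain V where V: "\<And>x. x \<in> {0<..<w N} \<Longrightarrow> \<exists>\<xi>. w \<xi> = x \<and> z \<xi> = V x"
    "\<And>x. x \<in> {0<..<w N} \<Longrightarrow> V x < 0"
    "\<And>x. x \<in> {0<..<w N} \<Longrightarrow> (V has_real_derivative force c x / (a * V x) + (\<epsilon> * a) / a) (at x)"
    "(V \<longlongrightarrow> 0) (at_right 0)"
    using travelling_wave_graph[OF *(1)[OF wz] \<open>a > 0\<close> *(2,4,5)[OF wz] N(2)] by blast
  \<comment> \<open>Below \<open>x0\<close> both graphs are defined, and \<open>u N < u0 c\<close>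
    makes the force nonnegative there, as \<open>graph_unique\<close> requires.\<close>
  define x0 where "x0 = min (u N) (w N)"
  have "x0 > 0" using *(2)[OF uv] *(2)[OF wz] by (simp add: x0_def)
  define x where "x = x0 / 2"
  have x: "x \<in> {0<..<x0}" using \<open>x0 > 0\<close> by (simp add: x_def)
  have "W x = V x"
  proof (rule graph_unique[OF \<open>a > 0\<close> _ _ _ _ _ W(4) V(4) x, where f = "force c" and b = "(\<epsilon> * a) / a"])
    show "0 \<le> force c y" if "y \<in> {0<..<x0}" for y
      using force_pos[OF \<open>c > 1\<close>, of y] that N(3) by (simp add: x0_def)
  qed (use W(2,3) V(2,3) in \<open>auto simp: x0_def\<close>)
  moreover obtain r where "u r = x" "v r = W x" using W(1)[of x] x by (auto simp: x0_def)
  moreover obtain s where "w s = x" "z s = V x" using V(1)[of x] x by (auto simp: x0_def)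
  \<comment> \<open>Equal graphs give a common phase point, reached by one orbit at time
    \<open>r\<close> and by the other at time \<open>s\<close>; the sought shift is
    \<open>r - s\<close>.\<close>
  ultimately have init: "w (0 + s) = u (0 + r)" "z (0 + s) = v (0 + r)" by simp_all
  have "w (\<xi> + s) = u (\<xi> + r) \<and> z (\<xi> + s) = v (\<xi> + r)" for \<xi>
    by (rule travelling_wave_unique[OF travelling_wave_shift travelling_wave_shift, OF *(1)[OF wz] *(1)[OF uv]
          _ _ init]) (rule *(3)[OF wz] *(3)[OF uv])+
  from this[of "_ - s"] have "w \<xi> = u (\<xi> + (r - s)) \<and> z \<xi> = v (\<xi> + (r - s))" for \<xi>
    by (simp add: algebra_simps)
  then show ?thesis by blast
qed

theorem theorem2p1:
  fixes \<delta> \<epsilon> c :: real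
  assumes "\<delta> > 0" and "\<epsilon> > 0" and "c > 1"
  shows "(\<exists>u v. connecting_solution \<delta> \<epsilon> c u v) \<and>
    (\<forall>u v w z. connecting_solution \<delta> \<epsilon> c u v \<and> connecting_solution \<delta> \<epsilon> c w z \<longrightarrow>
       (\<exists>s. \<forall>\<xi>. w \<xi> = u (\<xi> + s) \<and> z \<xi> = v (\<xi> + s)))"
  using connecting_solution_exists[OF assms] connecting_solution_unique[OF assms] by blast

end
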